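(* There is a polynomial time algorithm that, given a $2P_3$-free graph $G$ together with an edge weight function $w$ on $E(G)$, determines a maximum weight acyclic matching in $G$, that is, an acyclic matching $M$ in $G$ maximizing $\sum_{e\in M}w(e)$ over all acyclic matchings in $G$.
   Context: All graphs are finite, simple, and undirected. A matching in a graph $G$ is a set of pairwise disjoint edges of $G$ (possibly empty). For a matching $M$ in $G$, let $V(M)$ be the set of vertices of $G$ incident with an edge in $M$, and let $G(M)$ be the subgraph of $G$ induced by $V(M)$. The matching $M$ is acyclic if $G(M)$ is a forest. $P_3$ is the path on three vertices, $2P_3$ is the disjoint union of two copies of $P_3$ (with no edges between them), and a graph is $2P_3$-free if it has no induced subgraph isomorphic to $2P_3$. Edge weights are rational numbers (given by their binary encoding), and polynomial time is measured in the encoding length of $(G,w)$. *)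

theory Defs
  imports Complex_Main "HOL-Computational_Algebra.Polynomial"
begin

section \<open>Finite simple graphs\<close>

type_synonym 'a graph = "'a set \<times> 'a set set"

abbreviation verts :: "'a graph \<Rightarrow> 'a set" where "verts G \<equiv> fst G"

abbreviation edges :: "'a graph \<Rightarrow> 'a set set" where "edges G \<equiv> snd G"

definition simple_graph :: "'a graph \<Rightarrow> bool" where
  "simple_graph G \<longleftrightarrow> finite (verts G) \<and>
     (\<forall>e \<in> edges G. \<exists>u \<in> verts G. \<exists>v \<in> verts G. u \<noteq> v \<and> e = {u, v})"

definition induced_subgraph :: "'a graph \<Rightarrow> 'a set \<Rightarrow> 'a graph" where
  "induced_subgraph G S = (verts G \<inter> S, {e \<in> edges G. e \<subseteq> S})"

definition isomorphic :: "'a graph \<Rightarrow> 'b graph \<Rightarrow> bool" where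
  "isomorphic G H \<longleftrightarrow> (\<exists>f. bij_betw f (verts G) (verts H) \<and>
     (\<forall>u \<in> verts G. \<forall>v \<in> verts G. {u, v} \<in> edges G \<longleftrightarrow> {f u, f v} \<in> edges H))"

definition free_of :: "'b graph \<Rightarrow> 'a graph \<Rightarrow> bool" where
  "free_of H G \<longleftrightarrow> \<not> (\<exists>S \<subseteq> verts G. isomorphic (induced_subgraph G S) H)"

definition path_graph :: "nat \<Rightarrow> nat graph" where
  "path_graph n = ({..<n}, {{i, Suc i} | i. Suc i < n})"

definition disjoint_union :: "'a graph \<Rightarrow> 'b graph \<Rightarrow> ('a + 'b) graph" where
  "disjoint_union G H =
     (Inl ` verts G \<union> Inr ` verts H, (\<lambda>e. Inl ` e) ` edges G \<union> (\<lambda>e. Inr ` e) ` edges H)"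

definition two_P3 :: "(nat + nat) graph" where
  "two_P3 = disjoint_union (path_graph 3) (path_graph 3)"

definition is_cycle :: "'a graph \<Rightarrow> 'a list \<Rightarrow> bool" where
  "is_cycle G vs \<longleftrightarrow> length vs \<ge> 3 \<and> distinct vs \<and> set vs \<subseteq> verts G \<and>
     (\<forall>i < length vs. {vs ! i, vs ! (Suc i mod length vs)} \<in> edges G)"

definition forest :: "'a graph \<Rightarrow> bool" where
  "forest G \<longleftrightarrow> (\<nexists>vs. is_cycle G vs)"


section \<open>Acyclic matchings\<close>

definition matching :: "'a graph \<Rightarrow> 'a set set \<Rightarrow> bool" where
  "matching G M \<longleftrightarrow> M \<subseteq> edges G \<and> pairwise disjnt M"

definition acyclic_matching :: "'a graph \<Rightarrow> 'a set set \<Rightarrow> bool" where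
  "acyclic_matching G M \<longleftrightarrow> matching G M \<and> forest (induced_subgraph G (\<Union> M))"

definition max_weight_acyclic_matching ::
    "'a graph \<Rightarrow> ('a set \<Rightarrow> rat) \<Rightarrow> 'a set set \<Rightarrow> bool" where
  "max_weight_acyclic_matching G w M \<longleftrightarrow> acyclic_matching G M \<and>
     (\<forall>M'. acyclic_matching G M' \<longrightarrow> (\<Sum>e\<in>M'. w e) \<le> (\<Sum>e\<in>M. w e))"


section \<open>Data, programs and running time\<close>

text \<open>
  Algorithms are programs of a first-order, call-by-value functional language on binary trees
  (pure Lisp with a single atom). Writing 0 for a leaf and 1 for an inner node, a preorder
  traversal codes a tree t by a bit string of length exactly \<open>nodes t\<close>, so \<open>nodes\<close> is the
  encoding length of a datum.
\<close>

datatype tree = Leaf | Node (left: tree) (right: tree)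
  where "left Leaf = Leaf" | "right Leaf = Leaf"

primrec nodes :: "tree \<Rightarrow> nat" where
  "nodes Leaf = 1"
| "nodes (Node a b) = Suc (nodes a + nodes b)"

datatype expr =
    Var nat
  | LeafE
  | NodeE expr expr
  | LeftE expr
  | RightE expr
  | IfLeaf expr expr expr
  | Call nat "expr list"

text \<open>
  A program is a finite list of function bodies; \<open>Call f es\<close> calls the f-th of them, and
  \<open>Var i\<close> is the i-th argument of the function being executed. Functions may be mutually
  recursive.
\<close>

type_synonym program = "expr list"

text \<open>
  \<open>eval P env e v t\<close>: in the environment env, expression e evaluates to v at cost t. Every step
  costs 1, except that reading a variable costs the size of the tree being copied. Hence the
  cost bounds the size of every value produced (\<open>eval_nodes_le\<close> below), there is no sharing of
  subtrees that is not paid for, and the cost is polynomially related to the running time of a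
  Turing machine.
\<close>

inductive eval :: "program \<Rightarrow> tree list \<Rightarrow> expr \<Rightarrow> tree \<Rightarrow> nat \<Rightarrow> bool"
  and evals :: "program \<Rightarrow> tree list \<Rightarrow> expr list \<Rightarrow> tree list \<Rightarrow> nat \<Rightarrow> bool"
  for P :: program
where
  eval_Var: "i < length env \<Longrightarrow> eval P env (Var i) (env ! i) (nodes (env ! i))"
| eval_LeafE: "eval P env LeafE Leaf 1"
| eval_NodeE: "eval P env a u s \<Longrightarrow> eval P env b v t \<Longrightarrow>
    eval P env (NodeE a b) (Node u v) (Suc (s + t))"
| eval_LeftE: "eval P env a v t \<Longrightarrow> eval P env (LeftE a) (left v) (Suc t)"
| eval_RightE: "eval P env a v t \<Longrightarrow> eval P env (RightE a) (right v) (Suc t)"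
| eval_IfLeaf_True: "eval P env c Leaf s \<Longrightarrow> eval P env a v t \<Longrightarrow>
    eval P env (IfLeaf c a b) v (Suc (s + t))"
| eval_IfLeaf_False: "eval P env c (Node u u') s \<Longrightarrow> eval P env b v t \<Longrightarrow>
    eval P env (IfLeaf c a b) v (Suc (s + t))"
| eval_Call: "f < length P \<Longrightarrow> evals P env es vs s \<Longrightarrow> eval P vs (P ! f) v t \<Longrightarrow>
    eval P env (Call f es) v (Suc (s + t))"
| evals_Nil: "evals P env [] [] 0"
| evals_Cons: "eval P env e v s \<Longrightarrow> evals P env es vs t \<Longrightarrow>
    evals P env (e # es) (v # vs) (s + t)"

lemma nodes_left_le: "nodes (left v) \<le> nodes v"
  by (cases v) auto

lemma nodes_right_le: "nodes (right v) \<le> nodes v"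
  by (cases v) auto

lemma eval_nodes_le:
  "eval P env e v t \<Longrightarrow> nodes v \<le> t"
  "evals P env es vs t \<Longrightarrow> sum_list (map nodes vs) \<le> t"
proof (induction rule: eval_evals.inducts)
  case (eval_LeftE env a v t)
  then show ?case using nodes_left_le[of v] by simp
next
  case (eval_RightE env a v t)
  then show ?case using nodes_right_le[of v] by simp
qed auto

lemma eval_deterministic:
  "eval P env e v t \<Longrightarrow> eval P env e v' t' \<Longrightarrow> v' = v \<and> t' = t"
  "evals P env es vs t \<Longrightarrow> evals P env es vs' t' \<Longrightarrow> vs' = vs \<and> t' = t"
proof (induction arbitrary: v' t' and vs' t' rule: eval_evals.inducts)
  case (eval_Var i env)
  then show ?case by (auto elim: eval.cases)
next
  case (eval_LeafE env)
  then show ?case by (auto elim: eval.cases)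
next
  case (eval_NodeE env a u s b v t)
  from eval_NodeE.prems show ?case
    by (cases rule: eval.cases) (auto dest: eval_NodeE.IH(2,4))
next
  case (eval_LeftE env a v t)
  from eval_LeftE.prems show ?case
    by (cases rule: eval.cases) (auto dest: eval_LeftE.IH(2))
next
  case (eval_RightE env a v t)
  from eval_RightE.prems show ?case
    by (cases rule: eval.cases) (auto dest: eval_RightE.IH(2))
next
  case (eval_IfLeaf_True env c s a v t b)
  from eval_IfLeaf_True.prems show ?case
    by (cases rule: eval.cases) (auto dest: eval_IfLeaf_True.IH(2,4))
next
  case (eval_IfLeaf_False env c u u' s b v t a)
  from eval_IfLeaf_False.prems show ?case
    by (cases rule: eval.cases) (auto dest: eval_IfLeaf_False.IH(2,4))
next
  case (eval_Call f env es vs s v t)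
  from eval_Call.prems show ?case
    by (cases rule: eval.cases) (auto dest: eval_Call.IH(3,5))
next
  case (evals_Nil env)
  then show ?case by (auto elim: evals.cases)
next
  case (evals_Cons env e v s es vs t)
  from evals_Cons.prems show ?case
    by (cases rule: evals.cases) (auto dest: evals_Cons.IH(2,4))
qed

definition runs :: "program \<Rightarrow> tree \<Rightarrow> tree \<Rightarrow> nat \<Rightarrow> bool" where
  "runs P x y t \<longleftrightarrow> eval P [x] (Call 0 [Var 0]) y t"


section \<open>Encodings\<close>

fun bits :: "nat \<Rightarrow> bool list" where
  "bits n = (if n = 0 then [] else odd n # bits (n div 2))"

declare bits.simps [simp del]

definition enc_bool :: "bool \<Rightarrow> tree" where
  "enc_bool b = (if b then Node Leaf Leaf else Leaf)"

definition enc_list :: "('a \<Rightarrow> tree) \<Rightarrow> 'a list \<Rightarrow> tree" where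
  "enc_list enc xs = foldr (\<lambda>x. Node (enc x)) xs Leaf"

definition enc_nat :: "nat \<Rightarrow> tree" where
  "enc_nat n = enc_list enc_bool (bits n)"

definition enc_int :: "int \<Rightarrow> tree" where
  "enc_int k = Node (enc_bool (k < 0)) (enc_nat (nat \<bar>k\<bar>))"

text \<open>\<open>quotient_of\<close> yields numerator and denominator in lowest terms.\<close>

definition enc_rat :: "rat \<Rightarrow> tree" where
  "enc_rat r = (case quotient_of r of (p, q) \<Rightarrow> Node (enc_int p) (enc_nat (nat q)))"

definition enc_edge :: "nat \<times> nat \<Rightarrow> tree" where
  "enc_edge e = (case e of (u, v) \<Rightarrow> Node (enc_nat u) (enc_nat v))"

definition edge_of :: "'a \<times> 'a \<Rightarrow> 'a set" where
  "edge_of e = {fst e, snd e}"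

text \<open>
  A set of edges is listed without repetition, in any order and with either order of the
  endpoints of each edge. Vertices are named by arbitrary natural numbers.
\<close>

definition lists_edges :: "(nat \<times> nat) list \<Rightarrow> nat set set \<Rightarrow> bool" where
  "lists_edges es E \<longleftrightarrow> distinct (map edge_of es) \<and> edge_of ` set es = E"

definition encodes_weighted_graph :: "nat graph \<Rightarrow> (nat set \<Rightarrow> rat) \<Rightarrow> tree \<Rightarrow> bool" where
  "encodes_weighted_graph G w x \<longleftrightarrow> (\<exists>vs es.
     distinct vs \<and> set vs = verts G \<and> lists_edges es (edges G) \<and>
     x = Node (enc_list enc_nat vs)
              (enc_list (\<lambda>e. Node (enc_edge e) (enc_rat (w (edge_of e)))) es))"

definition encodes_edge_set :: "nat set set \<Rightarrow> tree \<Rightarrow> bool" where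
  "encodes_edge_set M y \<longleftrightarrow> (\<exists>es. lists_edges es M \<and> y = enc_list enc_edge es)"

lemma enc_list_inj: "inj enc \<Longrightarrow> inj (enc_list enc)"
proof (rule injI)
  fix xs ys assume "inj enc" "enc_list enc xs = enc_list enc ys"
  then show "xs = ys"
  proof (induction xs arbitrary: ys)
    case Nil
    then show ?case by (cases ys) (auto simp: enc_list_def)
  next
    case (Cons x xs)
    then show ?case by (cases ys) (auto simp: enc_list_def dest: injD)
  qed
qed

lemma bits_inj: "inj bits"
proof (rule injI)
  fix m n show "bits m = bits n \<Longrightarrow> m = n"
  proof (induction m arbitrary: n rule: bits.induct)
    case (1 m)
    show ?case
    proof (cases "m = 0 \<or> n = 0")
      case True then show ?thesis using 1(2) by (auto simp: bits.simps split: if_splits)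
    next
      case False
      then have a: "odd m = odd n" "bits (m div 2) = bits (n div 2)" using 1(2) bits.simps[of m] bits.simps[of n] by auto
      have "m div 2 = n div 2" using 1(1) a False by blast
      then show ?thesis using a(1) by (metis div_mult_mod_eq odd_iff_mod_2_eq_one even_iff_mod_2_eq_zero)
    qed
  qed
qed

lemma enc_nat_inj: "inj enc_nat"
  unfolding enc_nat_def
  using enc_list_inj[of enc_bool] bits_inj by (auto simp: inj_def enc_bool_def split: if_splits)

lemma encodes_edge_set_unique:
  "encodes_edge_set M y \<Longrightarrow> encodes_edge_set M' y \<Longrightarrow> M = M'"
proof -
  have "inj enc_edge" using enc_nat_inj by (auto simp: inj_def enc_edge_def)
  from enc_list_inj[OF this] show "encodes_edge_set M y \<Longrightarrow> encodes_edge_set M' y \<Longrightarrow> M = M'"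
  unfolding encodes_edge_set_def lists_edges_def by (auto dest: injD)
qed

lemma enc_rat_inj: "inj enc_rat"
proof (rule injI)
  fix r s assume h: "enc_rat r = enc_rat s"
  obtain p q where 1: "quotient_of r = (p,q)" by force
  obtain p' q' where 2: "quotient_of s = (p',q')" by force
  have "q>0" "q'>0" using 1 2 quotient_of_denom_pos by auto
  with h 1 2 have "p = p'" "q = q'" 
    by (auto simp: enc_rat_def enc_int_def enc_bool_def inj_eq[OF enc_nat_inj] split: if_splits)
  then show "r = s" using 1 2 by (metis quotient_of_inject)
qed

lemma ex_encodes_weighted_graph:
  "simple_graph (G::nat graph) \<Longrightarrow> \<exists>x. encodes_weighted_graph G w x"
proof -
  assume s: "simple_graph G"
  then have f: "finite (edges G)" unfolding simple_graph_def
    by (metis (no_types, lifting) PowI finite_Pow_iff finite_subset insert_subset empty_subsetI subsetI)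
  obtain vs where "distinct vs" "set vs = verts G" using s finite_distinct_list simple_graph_def by metis
  obtain L where L: "distinct L" "set L = edges G" using finite_distinct_list f by metis
  define es where "es = map (\<lambda>e. SOME p. edge_of p = e) L"
  have "edge_of (SOME p. edge_of p = e) = e" if "e \<in> set L" for e
    by (rule someI_ex) (use s that L in \<open>auto simp: simple_graph_def edge_of_def; metis\<close>)
  then have "map edge_of es = L" by (auto simp: es_def intro: map_idI)
  then have "lists_edges es (edges G)" using L by (metis lists_edges_def set_map)
  then show ?thesis using \<open>distinct vs\<close> \<open>set vs = _\<close> unfolding encodes_weighted_graph_def by blast
qed

end

theory Submission imports Defs begin

text \<open>Contract the edges of an acyclic matching M. Since G is \<open>2P\<^sub>3\<close>-free, the result is a
  \<open>2K\<^sub>2\<close>-free forest, so its edges are covered by two adjacent vertices: either no two edges of M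
  are joined by an edge of G, or this holds after deleting two edges e, f of M. Conversely, an
  induced matching of edges each of which sends at most one edge to \<open>e \<union> f\<close> can be added to e and f.
  After guessing e and f it remains to find a maximum weight independent set in the conflict graph
  of the admissible edges, which is again \<open>2P\<^sub>3\<close>-free.

  In a \<open>2P\<^sub>3\<close>-free graph every independent set is contained in one of polynomially many sets that
  induce disjoint unions of cliques: extend a set greedily by one vertex after the other, and
  whenever a vertex v of the independent set would complete an induced path v, a, b, restart from
  a set determined by v, a, b and the at most two elements of the independent set in the cliques
  of a and b. In a disjoint union of cliques the problem is trivial.

  The program is not written down. Instead the class of functions computable in polynomial time is
  shown to be closed under composition and suitable recursion.\<close>

section \<open>Functions computable in polynomial time\<close>

text \<open>On the machine side the obstacle is iteration: a polynomial-time step may enlarge its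
  argument, and iterating it may then be exponential. Closure under recursion therefore demands a
  polynomial bound on all intermediate results (\<open>q\<close> in \<open>PF_rec\<close>), which
  every loop has to supply. On the graph side, a graph without induced three-vertex paths is a
  disjoint union of cliques. Hence two disjoint edges with exactly one connecting edge contain an
  induced path between them, and so do three edges forming an induced path in the conflict graph.
  This is how both the contracted forest and the conflict graph inherit a forbidden structure from
  G. In the covered case, any further edge of M is isolated or a leaf in the contracted forest,
  whence the limit of one connecting edge. The restarts do not multiply: the set used for a restart
  already contains everything met so far of the independent set, so only the last restart matters.
  It is determined by five vertices; with e and f this makes seven nested guesses.\<close>

lemma poly_nat_mono: "x \<le> y \<Longrightarrow> poly p x \<le> poly p (y::nat)"
  by (induction p) (auto intro: add_mono mult_mono)

definition sz :: "tree list \<Rightarrow> nat" where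
  "sz env = sum_list (map nodes env)"

lemma sz_simps [simp]: "sz [] = 0" "sz (x # xs) = nodes x + sz xs" "sz (xs @ ys) = sz xs + sz ys"
  by (auto simp: sz_def)

lemma nodes_pos [simp]: "0 < nodes t"
  by (cases t) auto

lemma nodes_nth_le_sz: "i < length env \<Longrightarrow> nodes (env ! i) \<le> sz env"
  unfolding sz_def by (rule member_le_sum_list) auto

text \<open>Arity and function form a single argument so that families of mixed arity can be handled
  by \<open>list_all2\<close>.\<close>

definition impl :: "program \<Rightarrow> nat poly \<Rightarrow> nat \<times> (tree list \<Rightarrow> tree) \<Rightarrow> expr \<Rightarrow> bool" where
  "impl P p = (\<lambda>(k, F) b. \<forall>env. length env = k \<longrightarrow>
     (\<exists>t. eval P env b (F env) t \<and> t \<le> poly p (sz env)))"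

text \<open>The code R may be placed at address n of any larger program. This makes it possible to
  combine programs without relocating calls.\<close>

definition PF :: "nat \<Rightarrow> (tree list \<Rightarrow> tree) \<Rightarrow> bool" where
  "PF k F \<longleftrightarrow> (\<forall>n. \<exists>R b p. \<forall>Q S. length Q = n \<longrightarrow> impl (Q @ R @ S) p (k, F) b)"

lemma implE:
  assumes "impl P p (k, F) b" "length env = k"
  obtains t where "eval P env b (F env) t" "t \<le> poly p (sz env)"
  using assms unfolding impl_def by auto

lemma impl_mono:
  assumes "impl P p kF b" "\<And>x. poly p x \<le> poly q x"
  shows "impl P q kF b"
  using assms unfolding impl_def by (fastforce intro: le_trans)

text \<open>Each code is compiled for the address just behind the previous one. A common bound is
  obtained by adding polynomials, whose coefficients are natural numbers.\<close>

lemma PF_list: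
  assumes "list_all (\<lambda>(k, F). PF k F) Fs"
  shows "\<exists>R bs p. \<forall>Q S. length Q = n \<longrightarrow> list_all2 (impl (Q @ R @ S) p) Fs bs"
  using assms
proof (induction Fs arbitrary: n)
  case Nil
  then show ?case by auto
next
  case (Cons kF Fs)
  obtain k F where kF: "kF = (k, F)" by force
  have "PF k F" using Cons.prems kF by simp
  then obtain R b p where 1: "\<And>Q S. length Q = n \<Longrightarrow> impl (Q @ R @ S) p (k, F) b"
    unfolding PF_def by blast
  obtain R' bs p' where
    2: "\<forall>Q S. length Q = n + length R \<longrightarrow> list_all2 (impl (Q @ R' @ S) p') Fs bs"
    using Cons.IH[of "n + length R"] Cons.prems by auto
  have "list_all2 (impl (Q @ (R @ R') @ S) (p + p')) (kF # Fs) (b # bs)" if "length Q = n" for Q S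
  proof -
    have "impl (Q @ (R @ R') @ S) (p + p') kF b"
      using impl_mono[OF 1[OF that, of "R' @ S"]] kF by simp
    moreover have "list_all2 (impl (Q @ (R @ R') @ S) (p + p')) Fs bs"
      using 2[rule_format, of "Q @ R" S] that by (auto elim!: list_all2_mono intro: impl_mono)
    ultimately show ?thesis by simp
  qed
  then show ?case by blast
qed

lemma PF_var: "i < k \<Longrightarrow> PF k (\<lambda>e. e ! i)"
  unfolding PF_def
proof (intro allI)
  fix n assume i: "i < k"
  have "\<forall>Q S. length Q = n \<longrightarrow> impl (Q @ [] @ S) [:0, 1:] (k, \<lambda>e. e ! i) (Var i)"
    using i by (auto simp: impl_def nodes_nth_le_sz intro!: exI eval_Var)
  then show "\<exists>R b p. \<forall>Q S. length Q = n \<longrightarrow> impl (Q @ R @ S) p (k, \<lambda>e. e ! i) b" by blast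
qed

lemma PF_Leaf: "PF k (\<lambda>e. Leaf)"
  unfolding PF_def
proof (intro allI)
  fix n
  have "\<forall>Q S. length Q = n \<longrightarrow> impl (Q @ [] @ S) [:1:] (k, \<lambda>e. Leaf) LeafE"
    by (auto simp: impl_def intro!: exI eval_LeafE)
  then show "\<exists>R b p. \<forall>Q S. length Q = n \<longrightarrow> impl (Q @ R @ S) p (k, \<lambda>e. Leaf) b" by blast
qed

lemma PF_Node:
  assumes "PF k A" "PF k B"
  shows "PF k (\<lambda>e. Node (A e) (B e))"
  unfolding PF_def
proof (intro allI)
  fix n
  obtain R bs p where R: "\<forall>Q S. length Q = n \<longrightarrow> list_all2 (impl (Q @ R @ S) p) [(k, A), (k, B)] bs"
    using PF_list[of "[(k, A), (k, B)]" n] assms by auto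
  \<comment> \<open>Any concrete program of length \<open>n\<close> serves to read off the shape of
    \<open>bs\<close>; this one is a dummy.\<close>
  from R[rule_format, of "replicate n LeafE" "[]"] obtain a b where "bs = [a, b]"
    by (auto simp: list_all2_Cons1)
  with R have *: "impl (Q @ R @ S) p (k, A) a" "impl (Q @ R @ S) p (k, B) b"
    if "length Q = n" for Q S using that by auto
  have "impl (Q @ R @ S) (1 + p + p) (k, \<lambda>e. Node (A e) (B e)) (NodeE a b)" if Q: "length Q = n" for Q S
    unfolding impl_def
  proof (clarsimp)
    fix env :: "tree list" assume k: "k = length env"
    obtain s where "eval (Q @ R @ S) env a (A env) s" "s \<le> poly p (sz env)"
      by (rule implE[OF *(1)[OF Q] k[symmetric]])
    moreover obtain t where "eval (Q @ R @ S) env b (B env) t" "t \<le> poly p (sz env)"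
      by (rule implE[OF *(2)[OF Q] k[symmetric]])
    ultimately show "\<exists>t. eval (Q @ R @ S) env (NodeE a b) (Node (A env) (B env)) t \<and>
        t \<le> Suc (poly p (sz env) + poly p (sz env))"
      by (intro exI[of _ "Suc (s + t)"]) (auto intro: eval_NodeE)
  qed
  then show "\<exists>R b p. \<forall>Q S. length Q = n \<longrightarrow> impl (Q @ R @ S) p (k, \<lambda>e. Node (A e) (B e)) b" by blast
qed

lemma PF_left:
  assumes "PF k A"
  shows "PF k (\<lambda>e. left (A e))"
  unfolding PF_def
proof (intro allI)
  fix n
  obtain R b p where *: "\<And>Q S. length Q = n \<Longrightarrow> impl (Q @ R @ S) p (k, A) b"
    using assms unfolding PF_def by blast
  have "impl (Q @ R @ S) (1 + p) (k, \<lambda>e. left (A e)) (LeftE b)" if "length Q = n" for Q S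
    using *[OF that, of S] by (fastforce simp: impl_def intro: eval_LeftE)
  then show "\<exists>R b p. \<forall>Q S. length Q = n \<longrightarrow> impl (Q @ R @ S) p (k, \<lambda>e. left (A e)) b" by blast
qed

lemma PF_right:
  assumes "PF k A"
  shows "PF k (\<lambda>e. right (A e))"
  unfolding PF_def
proof (intro allI)
  fix n
  obtain R b p where *: "\<And>Q S. length Q = n \<Longrightarrow> impl (Q @ R @ S) p (k, A) b"
    using assms unfolding PF_def by blast
  have "impl (Q @ R @ S) (1 + p) (k, \<lambda>e. right (A e)) (RightE b)" if "length Q = n" for Q S
    using *[OF that, of S] by (fastforce simp: impl_def intro: eval_RightE)
  then show "\<exists>R b p. \<forall>Q S. length Q = n \<longrightarrow> impl (Q @ R @ S) p (k, \<lambda>e. right (A e)) b" by blast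
qed

lemma eval_IfLeaf:
  assumes "eval P env c u s" "eval P env (if u = Leaf then a else b) v t"
  shows "eval P env (IfLeaf c a b) v (Suc (s + t))"
  using assms by (cases u) (auto intro: eval_IfLeaf_True eval_IfLeaf_False)

lemma PF_IfLeaf:
  assumes "PF k C" "PF k A" "PF k B"
  shows "PF k (\<lambda>e. if C e = Leaf then A e else B e)"
  unfolding PF_def
proof (intro allI)
  fix n
  obtain R bs p where R: "\<forall>Q S. length Q = n \<longrightarrow> list_all2 (impl (Q @ R @ S) p) [(k, C), (k, A), (k, B)] bs"
    using PF_list[of "[(k, C), (k, A), (k, B)]" n] assms by auto
  from R[rule_format, of "replicate n LeafE" "[]"] obtain c a b where "bs = [c, a, b]"
    by (auto simp: list_all2_Cons1)
  with R have *: "impl (Q @ R @ S) p (k, C) c" "impl (Q @ R @ S) p (k, A) a"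
    "impl (Q @ R @ S) p (k, B) b" if "length Q = n" for Q S using that by auto
  have "impl (Q @ R @ S) (1 + p + p) (k, \<lambda>e. if C e = Leaf then A e else B e) (IfLeaf c a b)"
    if Q: "length Q = n" for Q S
    unfolding impl_def
  proof (clarify)
    fix env :: "tree list" assume k: "k = length env"
    obtain s where "eval (Q @ R @ S) env c (C env) s" "s \<le> poly p (sz env)"
      by (rule implE[OF *(1)[OF Q] k[symmetric]])
    moreover obtain t where "eval (Q @ R @ S) env a (A env) t" "t \<le> poly p (sz env)"
      by (rule implE[OF *(2)[OF Q] k[symmetric]])
    moreover obtain u where "eval (Q @ R @ S) env b (B env) u" "u \<le> poly p (sz env)"
      by (rule implE[OF *(3)[OF Q] k[symmetric]])
    ultimately show "\<exists>t. eval (Q @ R @ S) env (IfLeaf c a b) (if C env = Leaf then A env else B env) t \<and>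
        t \<le> poly (1 + p + p) (sz env)"
      by (intro exI[of _ "Suc (s + (if C env = Leaf then t else u))"]) (auto intro!: eval_IfLeaf)
  qed
  then show "\<exists>R b p. \<forall>Q S. length Q = n \<longrightarrow>
    impl (Q @ R @ S) p (k, \<lambda>e. if C e = Leaf then A e else B e) b" by blast
qed

lemma evals_list:
  assumes "list_all2 (impl P p) (map (Pair (length env)) Gs) bs"
  shows "\<exists>t. evals P env bs (map (\<lambda>G. G env) Gs) t \<and> t \<le> length Gs * poly p (sz env)"
  using assms
proof (induction Gs arbitrary: bs)
  case Nil
  then show ?case by (auto intro: evals_Nil)
next
  case (Cons G Gs)
  then obtain b bs' where bs: "bs = b # bs'" "impl P p (length env, G) b"
    "list_all2 (impl P p) (map (Pair (length env)) Gs) bs'" by (auto simp: list_all2_Cons1)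
  from Cons.IH[OF bs(3)] obtain t where t: "evals P env bs' (map (\<lambda>G. G env) Gs) t"
    "t \<le> length Gs * poly p (sz env)" by blast
  obtain s where "eval P env b (G env) s" "s \<le> poly p (sz env)"
    using bs(2) by (auto simp: impl_def)
  then show ?case using t bs(1)
    by (intro exI[of _ "s + t"]) (auto intro: evals_Cons)
qed

text \<open>\<open>Var i\<close> always refers to the arguments of the running function, so
  evaluating \<open>F\<close> on new arguments requires a call. The body of \<open>F\<close> is
  therefore appended to the code as a function of its own.\<close>

lemma PF_comp:
  assumes "PF (length Gs) F" "\<And>G. G \<in> set Gs \<Longrightarrow> PF k G"
  shows "PF k (\<lambda>e. F (map (\<lambda>G. G e) Gs))"
  unfolding PF_def
proof (intro allI)
  fix n
  let ?m = "length Gs"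
  obtain R bs p where R: "\<forall>Q S. length Q = n \<longrightarrow>
      list_all2 (impl (Q @ R @ S) p) ((?m, F) # map (Pair k) Gs) bs"
    using PF_list[of "(?m, F) # map (Pair k) Gs" n] assms by (auto simp: list_all_iff)
  from R[rule_format, of "replicate n LeafE" "[]"] obtain f gs where "bs = f # gs" by (auto simp: list_all2_Cons1)
  with R have *: "impl (Q @ R @ S) p (?m, F) f"
    "list_all2 (impl (Q @ R @ S) p) (map (Pair k) Gs) gs" if "length Q = n" for Q S using that by auto
  define q where "q = smult ?m p"
  have "impl (Q @ (R @ [f]) @ S) (1 + q + pcompose p q) (k, \<lambda>e. F (map (\<lambda>G. G e) Gs))
      (Call (n + length R) gs)" if Q: "length Q = n" for Q S
    unfolding impl_def
  proof (clarify)
    fix env :: "tree list" assume k: "k = length env"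
    let ?P = "Q @ (R @ [f]) @ S" and ?vs = "map (\<lambda>G. G env) Gs"
    obtain s where s: "evals ?P env gs ?vs s" "s \<le> poly q (sz env)"
      using evals_list[of ?P p env Gs gs] *(2)[OF Q, of "[f] @ S"] k by (auto simp: q_def)
    obtain t where t: "eval ?P ?vs f (F ?vs) t" "t \<le> poly p (sz ?vs)"
      using *(1)[OF Q, of "[f] @ S"] by (auto elim: implE[where env = ?vs])
    \<comment> \<open>A value is no larger than the cost of producing it, so the time spent on the
      arguments also bounds their size.\<close>
    have "sz ?vs \<le> poly q (sz env)"
      using eval_nodes_le(2)[OF s(1)] s(2) by (simp add: sz_def)
    then have "t \<le> poly (pcompose p q) (sz env)"
      using t(2) poly_nat_mono[of _ _ p] by (metis le_trans poly_pcompose)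
    moreover have "eval ?P env (Call (n + length R) gs) (F ?vs) (Suc (s + t))"
      using s t Q by (intro eval_Call) (auto simp: nth_append)
    ultimately show "\<exists>t. eval ?P env (Call (n + length R) gs) (F ?vs) t \<and>
        t \<le> poly (1 + q + pcompose p q) (sz env)"
      using s(2) by (intro exI[of _ "Suc (s + t)"]) auto
  qed
  then show "\<exists>R b p. \<forall>Q S. length Q = n \<longrightarrow> impl (Q @ R @ S) p (k, \<lambda>e. F (map (\<lambda>G. G e) Gs)) b"
    by blast
qed

lemma PF_cong:
  assumes "PF k F" "\<And>e. length e = k \<Longrightarrow> F' e = F e"
  shows "PF k F'"
  using assms unfolding PF_def impl_def by simp

lemma PF_size:
  assumes "PF k F"
  shows "\<exists>p. \<forall>e. length e = k \<longrightarrow> nodes (F e) \<le> poly p (sz e)"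
proof -
  obtain R b p where *: "\<And>Q S. length Q = 0 \<Longrightarrow> impl (Q @ R @ S) p (k, F) b"
    using assms unfolding PF_def by blast
  have "impl R p (k, F) b" using *[of "[]" "[]"] by simp
  then show ?thesis
    unfolding impl_def case_prod_conv by (meson eval_nodes_le(1) le_trans)
qed

text \<open>The depth is at most \<open>m e\<close> and arguments never outgrow the initial ones, so
  each level costs at most a fixed polynomial in the initial size. The bound \<open>q\<close>
  prevents the iterated \<open>H\<close> from building up exponentially large results.\<close>

lemma PF_rec:
  fixes m :: "tree list \<Rightarrow> nat"
  assumes PF: "PF k C" "PF k G" "PF (Suc k) H" "length Rs = k" "\<And>r. r \<in> set Rs \<Longrightarrow> PF k r"
    and F: "\<And>e. length e = k \<Longrightarrow>
      F e = (if C e = Leaf then G e else H (F (map (\<lambda>r. r e) Rs) # e))"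
    and m: "\<And>e. length e = k \<Longrightarrow> m e \<le> sz e"
      "\<And>e. length e = k \<Longrightarrow> C e \<noteq> Leaf \<Longrightarrow> m (map (\<lambda>r. r e) Rs) < m e"
      "\<And>e. length e = k \<Longrightarrow> C e \<noteq> Leaf \<Longrightarrow> sz (map (\<lambda>r. r e) Rs) \<le> sz e"
    and q: "\<And>e. length e = k \<Longrightarrow> nodes (F e) \<le> poly q (sz e)"
  shows "PF k F"
  unfolding PF_def
proof (intro allI)
  fix n
  obtain R bs p where R: "\<forall>Q S. length Q = n \<longrightarrow>
      list_all2 (impl (Q @ R @ S) p) ((k, C) # (k, G) # (Suc k, H) # map (Pair k) Rs) bs"
    using PF_list[of "(k, C) # (k, G) # (Suc k, H) # map (Pair k) Rs" n] PF by (auto simp: list_all_iff)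
  from R[rule_format, of "replicate n LeafE" "[]"] obtain c g h rs where "bs = c # g # h # rs"
    by (auto simp: list_all2_Cons1)
  with R have *: "impl (Q @ R @ S) p (k, C) c" "impl (Q @ R @ S) p (k, G) g"
    "impl (Q @ R @ S) p (Suc k, H) h"
    "list_all2 (impl (Q @ R @ S) p) (map (Pair k) Rs) rs" if "length Q = n" for Q S
    using that by auto
  \<comment> \<open>\<open>h\<close> gets address \<open>l\<close>, and the recursive body
    \<open>b\<close> gets address \<open>Suc l\<close>, where it calls itself. As \<open>h\<close>
    runs in a new environment, \<open>vars\<close> hands all parameters on to it.\<close>
  define l where "l = n + length R"
  define vars where "vars = map Var [0..<k]"
  define b where "b = IfLeaf c g (Call l (Call (Suc l) rs # vars))"
  define R' where "R' = R @ [h, b]"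
  \<comment> \<open>In order: overhead and reading \<open>vars\<close>, the condition, the base
    case, the new arguments, and \<open>h\<close> on an input of size at most
    \<open>s + poly q s\<close>.\<close>
  define p' where "p' = [:5, 1:] + p + p + smult k p + pcompose p ([:0, 1:] + q)"
  have vars: "\<exists>t. evals P e vars e t \<and> t \<le> sz e" if "length e = k" for P e
  proof -
    have "\<exists>t. evals P e (map Var [i..<k]) (drop i e) t \<and> t \<le> sz (drop i e)" if "i \<le> k" for i
      using that
    proof (induction rule: inc_induct)
      case base
      then show ?case using \<open>length e = k\<close> by (auto intro: evals_Nil)
    next
      case (step i)
      then obtain t where t: "evals P e (map Var [Suc i..<k]) (drop (Suc i) e) t"
        "t \<le> sz (drop (Suc i) e)" by blast
      have d: "drop i e = e ! i # drop (Suc i) e"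
        using step \<open>length e = k\<close> by (simp add: Cons_nth_drop_Suc)
      have "evals P e (map Var [i..<k]) (drop i e) (nodes (e ! i) + t)"
        using t step \<open>length e = k\<close> by (auto simp: d upt_conv_Cons intro!: evals_Cons eval_Var)
      then show ?case using t(2) by (auto simp: d)
    qed
    from this[of 0] show ?thesis by (simp add: vars_def)
  qed
  \<comment> \<open>\<open>s\<close> stays fixed while \<open>e\<close> changes, so that all levels
    share the bound \<open>poly p' s\<close>.\<close>
  have main: "\<exists>t. eval (Q @ R' @ S) e b (F e) t \<and> t \<le> Suc (m e) * poly p' s"
    if Q: "length Q = n" and "length e = k" "sz e \<le> s" for Q S e s
    using that(2,3)
  proof (induction "m e" arbitrary: e rule: less_induct)
    case less
    let ?P = "Q @ R' @ S"
    have P: "impl ?P p (k, C) c" "impl ?P p (k, G) g" "impl ?P p (Suc k, H) h"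
      "list_all2 (impl ?P p) (map (Pair k) Rs) rs"
      using *[OF Q, of "[h, b] @ S"] by (auto simp: R'_def)
    have len: "length ?P > Suc l" "?P ! l = h" "?P ! Suc l = b"
      using Q by (auto simp: R'_def l_def nth_append)
    have pm: "poly p (sz e) \<le> poly p s" using less.prems poly_nat_mono by blast
    obtain tc where tc: "eval ?P e c (C e) tc" "tc \<le> poly p s"
      using P(1) less.prems pm by (auto simp: impl_def intro: le_trans)
    show ?case
    proof (cases "C e = Leaf")
      case True
      obtain tg where "eval ?P e g (G e) tg" "tg \<le> poly p s"
        using P(2) less.prems pm by (auto simp: impl_def intro: le_trans)
      then show ?thesis using tc True F[OF less.prems(1)]
        by (intro exI[of _ "Suc (tc + tg)"])
          (auto simp: b_def p'_def algebra_simps intro!: eval_IfLeaf)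
    next
      case False
      let ?e = "map (\<lambda>r. r e) Rs"
      obtain tr where tr: "evals ?P e rs ?e tr" "tr \<le> k * poly p s"
        using evals_list[of ?P p e Rs rs] P(4) less.prems(1) PF(4) pm
        by (metis mult_le_mono2 order_trans)
      have "sz ?e \<le> s" using m(3)[OF less.prems(1) False] less.prems(2) by simp
      then obtain t where t: "eval ?P ?e b (F ?e) t" "t \<le> Suc (m ?e) * poly p' s"
        using less.hyps[of ?e] m(2)[OF less.prems(1) False] PF(4) by auto
      have 1: "eval ?P e (Call (Suc l) rs) (F ?e) (Suc (tr + t))"
        using tr t len by (intro eval_Call) auto
      obtain tv where tv: "evals ?P e vars e tv" "tv \<le> s"
        using vars[OF less.prems(1)] less.prems(2) by (meson le_trans)
      have 2: "evals ?P e (Call (Suc l) rs # vars) (F ?e # e) (Suc (tr + t) + tv)"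
        by (rule evals_Cons[OF 1 tv(1)])
      obtain th where th: "eval ?P (F ?e # e) h (H (F ?e # e)) th" "th \<le> poly p (sz (F ?e # e))"
  by (rule implE[OF P(3), of "F ?e # e"]) (use less.prems(1) in auto)
      have "nodes (F ?e) \<le> poly q s"
        using q[of ?e] PF(4) \<open>sz ?e \<le> s\<close> poly_nat_mono[of "sz ?e" s q] by simp
      then have "sz (F ?e # e) \<le> s + poly q s" using less.prems(2) by simp
      then have th2: "th \<le> poly p (s + poly q s)"
        using th(2) poly_nat_mono le_trans by blast
      have 3: "eval ?P e (Call l (Call (Suc l) rs # vars)) (F e)
          (Suc (Suc (tr + t) + tv + th))"
        using eval_Call[OF _ 2, of l "H (F ?e # e)" th] th(1) len F[OF less.prems(1)] False by simp
      have "eval ?P e b (F e) (Suc (tc + Suc (Suc (tr + t) + tv + th)))"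
        unfolding b_def using 3 False by (intro eval_IfLeaf[OF tc(1)]) simp
      moreover have "Suc (tc + Suc (Suc (tr + t) + tv + th)) \<le> poly p' s + t"
        using tc(2) tr(2) tv(2) th2 by (simp add: p'_def poly_pcompose)
      moreover have "t \<le> m e * poly p' s"
        using t(2) m(2)[OF less.prems(1) False]
        by (meson Suc_leI le_trans mult_le_mono1)
      ultimately show ?thesis
        by (intro exI[of _ "Suc (tc + Suc (Suc (tr + t) + tv + th))"]) simp
    qed
  qed
  have "impl (Q @ R' @ S) ([:1, 1:] * p') (k, F) b" if Q: "length Q = n" for Q S
    unfolding impl_def
  proof clarify
    fix e :: "tree list" assume k: "k = length e"
    obtain t where t: "eval (Q @ R' @ S) e b (F e) t" "t \<le> Suc (m e) * poly p' (sz e)"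
      using main[OF Q k[symmetric] order_refl] by blast
    have "Suc (m e) * poly p' (sz e) \<le> Suc (sz e) * poly p' (sz e)"
      using m(1)[of e] k by (intro mult_le_mono1) simp
    then have "t \<le> Suc (sz e) * poly p' (sz e)" using t(2) le_trans by blast
    then show "\<exists>t. eval (Q @ R' @ S) e b (F e) t \<and> t \<le> poly ([:1, 1:] * p') (sz e)"
      using t(1) by (intro exI[of _ t]) (simp add: algebra_simps)
  qed
  then show "\<exists>R b p. \<forall>Q S. length Q = n \<longrightarrow> impl (Q @ R @ S) p (k, F) b" by blast
qed

section \<open>Lists, Booleans and loops\<close>

text \<open>Every tree is the code of exactly one list of trees.\<close>

primrec elems :: "tree \<Rightarrow> tree list" where
  "elems Leaf = []"
| "elems (Node a b) = a # elems b"

abbreviation lst :: "tree list \<Rightarrow> tree" where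
  "lst \<equiv> enc_list (\<lambda>x. x)"

lemma lst_simps [simp]: "lst [] = Leaf" "lst (x # xs) = Node x (lst xs)"
  by (auto simp: enc_list_def)

lemma elems_lst [simp]: "elems (lst xs) = xs"
  by (induction xs) auto

lemma lst_elems [simp]: "lst (elems t) = t"
  by (induction t) auto

lemma nodes_mem_lst: "x \<in> set xs \<Longrightarrow> nodes x < nodes (lst xs)"
  by (induction xs) auto

abbreviation PFB :: "nat \<Rightarrow> (tree list \<Rightarrow> bool) \<Rightarrow> bool" where
  "PFB k b \<equiv> PF k (\<lambda>e. enc_bool (b e))"

abbreviation PFL :: "nat \<Rightarrow> (tree list \<Rightarrow> tree list) \<Rightarrow> bool" where
  "PFL k xs \<equiv> PF k (\<lambda>e. lst (xs e))"

lemma enc_bool_eq_Leaf [simp]: "enc_bool b = Leaf \<longleftrightarrow> \<not> b"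
  by (simp add: enc_bool_def)

lemma nodes_enc_bool_le: "nodes (enc_bool b) \<le> 3"
  by (simp add: enc_bool_def)

text \<open>Loop variables are pushed onto the front of the environment, as with de Bruijn indices;
  \<open>hd\<close> and \<open>tl\<close> name positions relative to that front.\<close>

lemma PF_var_tl: "i < k \<Longrightarrow> PF k (\<lambda>e. hd ((tl ^^ i) e))"
proof (rule PF_cong[OF PF_var])
  fix e :: "tree list" assume "i < k" "length e = k"
  moreover have "(tl ^^ j) e = drop j e" for j
    by (induction j) (auto simp: drop_Suc tl_drop)
  ultimately show "hd ((tl ^^ i) e) = e ! i"
    by (simp add: hd_drop_conv_nth)
qed

lemma PF_weaken: "PF k F \<Longrightarrow> PF (Suc k) (\<lambda>e. F (tl e))"
proof -
  assume "PF k F"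
  then have "PF (Suc k) (\<lambda>e. F (map (\<lambda>G. G e) (map (\<lambda>i e. e ! Suc i) [0..<k])))"
    by (intro PF_comp) (auto intro: PF_var)
  then show ?thesis
    by (rule PF_cong) (auto simp: length_Suc_conv comp_def map_nth)
qed

lemmas PF_vars =
  PF_var_tl[of 0, simplified] PF_var_tl[of "Suc 0", simplified] PF_var_tl[of "Suc (Suc 0)", simplified]
  PF_var_tl[of "Suc (Suc (Suc 0))", simplified] PF_var_tl[of "Suc (Suc (Suc (Suc 0)))", simplified]

text \<open>A loop body sees the item, the accumulator and the outer environment. This skips the
  accumulator for tests that do not read it.\<close>

lemma PF_weaken_snd:
  assumes "PF (Suc k) (\<lambda>e. F (hd e) (tl e))"
  shows "PF (Suc (Suc k)) (\<lambda>e. F (hd e) (tl (tl e)))"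
proof -
  have "PF (Suc (Suc k)) (\<lambda>e. (\<lambda>e. F (hd e) (tl e))
    (map (\<lambda>G. G e) ((\<lambda>e. e ! 0) # map (\<lambda>i e. e ! Suc (Suc i)) [0..<k])))"
    using assms by (intro PF_comp) (auto intro: PF_var)
  then show ?thesis
    by (rule PF_cong) (auto simp: length_Suc_conv comp_def map_nth)
qed

lemma PF_comp3:
  assumes "PF 3 (\<lambda>e. f (e ! 0) (e ! 1) (e ! 2))" "PF k A" "PF k B" "PF k C"
  shows "PF k (\<lambda>e. f (A e) (B e) (C e))"
proof -
  have "PF k (\<lambda>e. (\<lambda>e. f (e ! 0) (e ! 1) (e ! 2)) (map (\<lambda>G. G e) [A, B, C]))"
    using assms by (intro PF_comp) (auto simp: numeral_3_eq_3)
  then show ?thesis by (rule PF_cong) simp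
qed

text \<open>The bound has to cover all lists, not just the one that is folded over, because the
  recursion passes through its suffixes.\<close>

lemma PF_foldr:
  assumes X: "PFL k xs" and G: "PF k G"
    and H: "PF (Suc (Suc k)) (\<lambda>e. H (hd e) (hd (tl e)) (tl (tl e)))"
    and q: "\<And>e ys. length e = k \<Longrightarrow>
      nodes (foldr (\<lambda>x acc. H x acc e) ys (G e)) \<le> poly q (nodes (lst ys) + sz e)"
  shows "PF k (\<lambda>e. foldr (\<lambda>x acc. H x acc e) (xs e) (G e))"
proof -
  \<comment> \<open>The list becomes an additional first parameter that the recursion shortens by
    \<open>right\<close>; the other parameters are passed on unchanged.\<close>
  let ?F = "\<lambda>e. foldr (\<lambda>x acc. H x acc (tl e)) (elems (hd e)) (G (tl e))"
  have "PF (Suc (Suc k)) (\<lambda>e. (\<lambda>e. H (hd e) (hd (tl e)) (tl (tl e)))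
    (map (\<lambda>G. G e) ((\<lambda>e. left (e ! 1)) # (\<lambda>e. e ! 0) # map (\<lambda>i e. e ! Suc (Suc i)) [0..<k])))"
    using H by (intro PF_comp) (auto intro: PF_var PF_left)
  \<comment> \<open>\<open>PF_rec\<close> puts the recursive result in front of the list, whereas
    \<open>H\<close> takes the item first.\<close>
  then have H': "PF (Suc (Suc k)) (\<lambda>e. H (left (hd (tl e))) (hd e) (tl (tl e)))"
    by (rule PF_cong) (auto simp: length_Suc_conv comp_def map_nth)
  have "PF (Suc k) ?F"
  proof (rule PF_rec[OF _ PF_weaken[OF G] H', where C = hd and m = "\<lambda>e. nodes (hd e)" and q = q
        and Rs = "(\<lambda>e. right (hd e)) # map (\<lambda>i e. e ! Suc i) [0..<k]"])
    show "PF (Suc k) r" if "r \<in> set ((\<lambda>e. right (hd e)) # map (\<lambda>i e. e ! Suc i) [0..<k])" for r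
      using that by (auto intro: PF_var PF_right PF_vars)
    show "nodes (?F e) \<le> poly q (sz e)" if "length e = Suc k" for e
      using that q[of "tl e" "elems (hd e)"] by (auto simp: length_Suc_conv)
  next
    fix e :: "tree list" assume "length e = Suc k"
    then obtain a e' where e: "e = a # e'" "length e' = k" by (auto simp: length_Suc_conv)
    let ?e = "map (\<lambda>r. r e) ((\<lambda>e. right (hd e)) # map (\<lambda>i e. e ! Suc i) [0..<k])"
    have e': "?e = right a # e'" using e by (auto simp: comp_def map_nth)
    show "?F e = (if hd e = Leaf then G (tl e)
        else H (left (hd (tl (?F ?e # e)))) (hd (?F ?e # e)) (tl (tl (?F ?e # e))))"
      unfolding e' by (cases a) (auto simp: e)
    show "hd e \<noteq> Leaf \<Longrightarrow> nodes (hd ?e) < nodes (hd e)"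
      unfolding e' by (cases a) (auto simp: e)
    show "hd e \<noteq> Leaf \<Longrightarrow> sz ?e \<le> sz e"
      unfolding e' by (cases a) (auto simp: e)
  qed (auto simp: length_Suc_conv intro: PF_vars)
  then have "PF k (\<lambda>e. ?F (map (\<lambda>G. G e) ((\<lambda>e. lst (xs e)) # map (\<lambda>i e. e ! i) [0..<k])))"
    using X by (intro PF_comp) (auto intro: PF_var)
  then show ?thesis
    by (rule PF_cong) (auto simp: comp_def map_nth)
qed

lemma PF_elems: "PF k X \<Longrightarrow> PFL k (\<lambda>e. elems (X e))"
  by simp

lemma PFL_Nil: "PFL k (\<lambda>e. [])"
  by (simp add: PF_Leaf)

lemma PFL_Cons: "PF k X \<Longrightarrow> PFL k xs \<Longrightarrow> PFL k (\<lambda>e. X e # xs e)"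
  by (simp add: PF_Node)

lemma PFB_True: "PFB k (\<lambda>e. True)"
  by (simp add: enc_bool_def PF_Node PF_Leaf)

lemma PFB_False: "PFB k (\<lambda>e. False)"
  by (simp add: enc_bool_def PF_Leaf)

lemma PF_If: "PFB k c \<Longrightarrow> PF k A \<Longrightarrow> PF k B \<Longrightarrow> PF k (\<lambda>e. if c e then A e else B e)"
  using PF_IfLeaf[of k "\<lambda>e. enc_bool (c e)" B A] by (rule PF_cong) auto

lemma PFL_If: "PFB k c \<Longrightarrow> PFL k A \<Longrightarrow> PFL k B \<Longrightarrow> PFL k (\<lambda>e. if c e then A e else B e)"
  by (rule PF_cong[OF PF_If[of k c "\<lambda>e. lst (A e)" "\<lambda>e. lst (B e)"]]) auto

lemma PFB_is_Leaf: "PF k A \<Longrightarrow> PFB k (\<lambda>e. A e = Leaf)"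
  by (rule PF_cong[OF PF_IfLeaf[OF _ PFB_True PFB_False]]) auto

lemma PFB_not: "PFB k a \<Longrightarrow> PFB k (\<lambda>e. \<not> a e)"
  by (rule PF_cong[OF PF_If[OF _ PFB_False PFB_True]]) auto

lemma PFB_conj: "PFB k a \<Longrightarrow> PFB k b \<Longrightarrow> PFB k (\<lambda>e. a e \<and> b e)"
  by (rule PF_cong[OF PF_If[of k a "\<lambda>e. enc_bool (b e)", OF _ _ PFB_False]]) auto

lemma PFB_disj: "PFB k a \<Longrightarrow> PFB k b \<Longrightarrow> PFB k (\<lambda>e. a e \<or> b e)"
  by (rule PF_cong[OF PF_If[of k a _ "\<lambda>e. enc_bool (b e)", OF _ PFB_True]]) auto

lemma PFB_imp: "PFB k a \<Longrightarrow> PFB k b \<Longrightarrow> PFB k (\<lambda>e. a e \<longrightarrow> b e)"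
  unfolding imp_conv_disj by (intro PFB_disj PFB_not)

lemma PFB_iff: "PFB k a \<Longrightarrow> PFB k b \<Longrightarrow> PFB k (\<lambda>e. a e \<longleftrightarrow> b e)"
  by (rule PF_cong[OF PF_If[of k a "\<lambda>e. enc_bool (b e)" "\<lambda>e. enc_bool (\<not> b e)", OF _ _ PFB_not]]) auto

lemma PFL_foldr:
  assumes X: "PFL k xs" and G: "PFL k G"
    and H: "PFL (Suc (Suc k)) (\<lambda>e. H (hd e) (elems (hd (tl e))) (tl (tl e)))"
    and q: "\<And>e ys. length e = k \<Longrightarrow>
      nodes (lst (foldr (\<lambda>x acc. H x acc e) ys (G e))) \<le> poly q (nodes (lst ys) + sz e)"
  shows "PFL k (\<lambda>e. foldr (\<lambda>x acc. H x acc e) (xs e) (G e))"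
proof -
  have *: "lst (foldr (\<lambda>x acc. H x acc e) ys (G e)) =
      foldr (\<lambda>x acc. lst (H x (elems acc) e)) ys (lst (G e))" for ys e
    by (induction ys) (simp_all, metis elems_lst)
  show ?thesis
    unfolding * using q unfolding * by (intro PF_foldr[OF X G H])
qed

text \<open>A step may add one node and the current item, exactly what that item occupies in the
  list folded over, so the result is never larger than this list and the start value
  together.\<close>

lemma PFL_foldr_grow:
  assumes "PFL k xs" and G: "PFL k G"
    and "PFL (Suc (Suc k)) (\<lambda>e. H (hd e) (elems (hd (tl e))) (tl (tl e)))"
    and H: "\<And>x acc e. nodes (lst (H x acc e)) \<le> Suc (nodes x + nodes (lst acc))"
  shows "PFL k (\<lambda>e. foldr (\<lambda>x acc. H x acc e) (xs e) (G e))"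
proof -
  obtain p where p: "length e = k \<Longrightarrow> nodes (lst (G e)) \<le> poly p (sz e)" for e
    using PF_size[OF G] by blast
  show ?thesis
  proof (rule PFL_foldr[OF assms(1-3), where q = "[:0, 1:] + p"])
    fix e ys assume e: "length (e :: tree list) = k"
    have "nodes (lst (foldr (\<lambda>x acc. H x acc e) ys (G e))) \<le> nodes (lst ys) + nodes (lst (G e))"
    proof (induction ys)
      case (Cons y ys)
      then show ?case using H[of y "foldr (\<lambda>x acc. H x acc e) ys (G e)" e] by simp
    qed simp
    also have "\<dots> \<le> nodes (lst ys) + poly p (nodes (lst ys) + sz e)"
      using p[OF e] poly_nat_mono[of "sz e" "nodes (lst ys) + sz e" p] by simp
    finally show "nodes (lst (foldr (\<lambda>x acc. H x acc e) ys (G e)))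
        \<le> poly ([:0, 1:] + p) (nodes (lst ys) + sz e)" by simp
  qed
qed

lemma PFB_ex:
  assumes "PFL k xs" "PFB (Suc k) (\<lambda>e. B (hd e) (tl e))"
  shows "PFB k (\<lambda>e. \<exists>x\<in>set (xs e). B x e)"
proof -
  have *: "enc_bool (\<exists>x\<in>set ys. B x e) =
      foldr (\<lambda>x acc. if B x e then enc_bool True else acc) ys (enc_bool False)" for e ys
    by (induction ys) (auto simp: enc_bool_def)
  have "nodes (foldr (\<lambda>x acc. if B x e then enc_bool True else acc) ys (enc_bool False)) \<le> 3" for e ys
    by (induction ys) (auto simp: nodes_enc_bool_le)
  then show ?thesis unfolding *
    by (intro PF_foldr[where q = "[:3:]", OF assms(1) PFB_False] PF_If PFB_True
        PF_weaken_snd[OF assms(2)] PF_vars) auto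
qed

lemma PFL_filter:
  assumes "PFL k xs" "PFB (Suc k) (\<lambda>e. B (hd e) (tl e))"
  shows "PFL k (\<lambda>e. filter (\<lambda>x. B x e) (xs e))"
proof -
  have *: "filter (\<lambda>x. B x e) ys = foldr (\<lambda>x acc. if B x e then x # acc else acc) ys []" for e ys
    by (induction ys) auto
  show ?thesis unfolding *
    by (intro PFL_foldr_grow[OF assms(1) PFL_Nil] PFL_If PFL_Cons PF_elems
        PF_weaken_snd[OF assms(2)] PF_vars) auto
qed

lemma PFL_map_left:
  assumes "PFL k xs"
  shows "PFL k (\<lambda>e. map left (xs e))"
proof -
  have *: "map left ys = foldr (\<lambda>x acc. left x # acc) ys []" for ys
    by (induction ys) auto
  show ?thesis unfolding *
    by (intro PFL_foldr_grow[OF assms PFL_Nil] PFL_Cons PF_left PF_elems PF_vars)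
      (auto simp: nodes_left_le)
qed

section \<open>Binary arithmetic\<close>

primrec val :: "tree \<Rightarrow> nat" where
  "val Leaf = 0"
| "val (Node b t) = of_bool (b \<noteq> Leaf) + 2 * val t"

lemma val_enc_nat [simp]: "val (enc_nat n) = n"
proof (induction n rule: bits.induct)
  case (1 n)
  show ?case
  proof (cases "n = 0")
    case False
    then have "enc_nat n = Node (enc_bool (odd n)) (enc_nat (n div 2))"
      by (simp add: enc_nat_def bits.simps[of n] enc_list_def)
    then show ?thesis using 1 False by simp
  qed (simp add: enc_nat_def bits.simps enc_list_def)
qed

text \<open>Ripple-carry addition: \<open>a = (b = c)\<close> is the exclusive or of the three bits,
  and the new carry is their majority.\<close>

function add :: "tree \<Rightarrow> tree \<Rightarrow> bool \<Rightarrow> tree" where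
  "add x y c = (if x = Leaf \<and> y = Leaf then if c then Node (enc_bool True) Leaf else Leaf
     else let a = (left x \<noteq> Leaf); b = (left y \<noteq> Leaf) in
       Node (enc_bool (a = (b = c))) (add (right x) (right y) (a \<and> b \<or> a \<and> c \<or> b \<and> c)))"
  by auto
termination
proof (relation "measure (\<lambda>(x, y, c). size x + size y)")
  fix x y c a b assume "\<not> (x = Leaf \<and> y = Leaf)"
  then show "((right x, right y, a \<and> b \<or> a \<and> c \<or> b \<and> c), x, y, c) \<in> measure (\<lambda>(x, y, c). size x + size y)"
    by (cases x; cases y) auto
qed auto

declare add.simps [simp del]

lemma val_left_right: "val x = of_bool (left x \<noteq> Leaf) + 2 * val (right x)"
  by (cases x) auto

lemma val_add [simp]: "val (add x y c) = val x + val y + of_bool c"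
proof (induction x y c rule: add.induct)
  case (1 x y c)
  show ?case
  proof (cases "x = Leaf \<and> y = Leaf")
    case False
    then show ?thesis
      using 1[OF False refl refl] val_left_right[of x] val_left_right[of y]
      by (subst add.simps) (auto simp: Let_def of_bool_def split: if_splits)
  qed (simp add: add.simps)
qed

text \<open>The two nodes are the list cell and at least one node of its digit.
  \<open>PF_rec\<close> forbids growing arguments; this slack pays for a carry that grows from one
  node to three.\<close>

lemma nodes_right_less: "x \<noteq> Leaf \<Longrightarrow> nodes (right x) + 2 \<le> nodes x"
  by (cases x; cases "left x") auto

lemma nodes_right_pair:
  assumes "\<not> (x = Leaf \<and> y = Leaf)"
  shows "nodes (right x) + nodes (right y) + 2 \<le> nodes x + nodes y"
  using assms nodes_right_less[of x] nodes_right_less[of y] nodes_right_le[of x] nodes_right_le[of y]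
  by fastforce

abbreviation len :: "tree \<Rightarrow> nat" where
  "len t \<equiv> length (elems t)"

lemma len_le_nodes: "len t < nodes t"
  by (induction t) auto

text \<open>Digits of arbitrary inputs may be large trees. Computed digits have at most three nodes,
  so that counting digits controls the size of results.\<close>

definition normal :: "tree \<Rightarrow> bool" where
  "normal t \<longleftrightarrow> (\<forall>b \<in> set (elems t). nodes b \<le> 3)"

lemma normal_simps [simp]: "normal Leaf" "normal (Node b t) \<longleftrightarrow> nodes b \<le> 3 \<and> normal t"
  by (auto simp: normal_def)

lemma nodes_normal: "normal t \<Longrightarrow> nodes t \<le> 4 * len t + 1"
  by (induction t) auto

lemma normal_add [simp]: "normal (add x y c)"
  by (induction x y c rule: add.induct) (subst add.simps, auto simp: Let_def nodes_enc_bool_le)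

lemma len_add: "len (add x y c) \<le> Suc (max (len x) (len y))"
proof (induction x y c rule: add.induct)
  case (1 x y c)
  show ?case
  proof (cases "x = Leaf \<and> y = Leaf")
    case False
    then show ?thesis
      using 1[OF False refl refl] by (subst add.simps) (cases x; cases y; auto simp: Let_def)
  qed (auto simp: add.simps)
qed

lemma PF_add:
  assumes "PF k A" "PF k B" "PFB k C"
  shows "PF k (\<lambda>e. add (A e) (B e) (C e))"
proof -
  let ?a = "\<lambda>e. left (e ! 0) \<noteq> Leaf" and ?b = "\<lambda>e. left (e ! 1) \<noteq> Leaf" and ?c = "\<lambda>e. e ! 2 \<noteq> Leaf"
  let ?Rs = "[\<lambda>e. right (e ! 0), \<lambda>e. right (e ! 1),
    \<lambda>e. enc_bool (?a e \<and> ?b e \<or> ?a e \<and> ?c e \<or> ?b e \<and> ?c e)]"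
  let ?F = "\<lambda>e. add (e ! 0) (e ! 1) (e ! 2 \<noteq> Leaf)"
  have "PF 3 ?F"
  proof (rule PF_rec[where C = "\<lambda>e. enc_bool (e ! 0 \<noteq> Leaf \<or> e ! 1 \<noteq> Leaf)"
        and G = "\<lambda>e. if e ! 2 = Leaf then Leaf else Node (enc_bool True) Leaf" and Rs = ?Rs
        and H = "\<lambda>e. Node (enc_bool ((left (e ! 1) \<noteq> Leaf) = ((left (e ! 2) \<noteq> Leaf) = (e ! 3 \<noteq> Leaf))))
          (e ! 0)"
        and m = "\<lambda>e. nodes (e ! 0) + nodes (e ! 1)" and q = "[:5, 4:]"])
    show "PF 3 r" if "r \<in> set ?Rs" for r
      using that by (auto intro!: PF_var PF_right PF_left PFB_not PFB_conj PFB_disj PFB_is_Leaf)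
    \<comment> \<open>\<open>len_add\<close> and \<open>nodes_normal\<close> give at most
      \<open>4 * (sz e + 1) + 1\<close> nodes.\<close>
    show "nodes (?F e) \<le> poly [:5, 4:] (sz e)" if "length e = 3" for e
      using that nodes_normal[of "?F e"] len_add[of "e ! 0" "e ! 1" "e ! 2 \<noteq> Leaf"]
        len_le_nodes[of "e ! 0"] len_le_nodes[of "e ! 1"]
      by (auto simp: length_Suc_conv numeral_3_eq_3)
  next
    fix e :: "tree list" assume "length e = 3"
    then obtain x y z where e: "e = [x, y, z]" by (auto simp: length_Suc_conv numeral_3_eq_3)
    show "?F e = (if enc_bool (e ! 0 \<noteq> Leaf \<or> e ! 1 \<noteq> Leaf) = Leaf
       then if e ! 2 = Leaf then Leaf else Node (enc_bool True) Leaf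
       else Node (enc_bool ((left ((?F (map (\<lambda>r. r e) ?Rs) # e) ! 1) \<noteq> Leaf) =
         ((left ((?F (map (\<lambda>r. r e) ?Rs) # e) ! 2) \<noteq> Leaf) = ((?F (map (\<lambda>r. r e) ?Rs) # e) ! 3 \<noteq> Leaf))))
          ((?F (map (\<lambda>r. r e) ?Rs) # e) ! 0))"
      by (subst add.simps) (simp add: e Let_def numeral_3_eq_3)
    assume "enc_bool (e ! 0 \<noteq> Leaf \<or> e ! 1 \<noteq> Leaf) \<noteq> Leaf"
    then have *: "\<not> (x = Leaf \<and> y = Leaf)" by (simp add: e)
    show "nodes (map (\<lambda>r. r e) ?Rs ! 0) + nodes (map (\<lambda>r. r e) ?Rs ! 1) < nodes (e ! 0) + nodes (e ! 1)"
      using nodes_right_pair[OF *] by (simp add: e)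
    have "nodes (right x) + (nodes (right y) + nodes (enc_bool b)) \<le> nodes x + (nodes y + nodes z)" for b
      using nodes_right_pair[OF *] nodes_enc_bool_le[of b] nodes_pos[of z] by linarith
    then show "sz (map (\<lambda>r. r e) ?Rs) \<le> sz e" by (simp add: e)
  qed (auto simp: length_Suc_conv numeral_3_eq_3 intro!: PF_var PF_right PF_left PFB_not PFB_imp PFB_iff
      PFB_is_Leaf PF_IfLeaf PF_Node PF_Leaf PFB_True)
  from PF_comp3[where f = "\<lambda>x y c. add x y (c \<noteq> Leaf)", OF this assms]
  show ?thesis by simp
qed

text \<open>\<open>c\<close> is the verdict of the less significant digits already read; a later,
  more significant difference overrides it.\<close>

function lessb :: "tree \<Rightarrow> tree \<Rightarrow> bool \<Rightarrow> bool" where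
  "lessb x y c = (if x = Leaf \<and> y = Leaf then c
     else let a = (left x \<noteq> Leaf); b = (left y \<noteq> Leaf) in
       lessb (right x) (right y) (\<not> a \<and> b \<or> a = b \<and> c))"
  by auto
termination
proof (relation "measure (\<lambda>(x, y, c). size x + size y)")
  fix x y c a b assume "\<not> (x = Leaf \<and> y = Leaf)"
  then show "((right x, right y, \<not> a \<and> b \<or> a = b \<and> c), x, y, c) \<in> measure (\<lambda>(x, y, c). size x + size y)"
    by (cases x; cases y) auto
qed auto

declare lessb.simps [simp del]

lemma less_iff: "lessb x y c \<longleftrightarrow> val x < val y \<or> val x = val y \<and> c"
proof (induction x y c rule: lessb.induct)
  case (1 x y c)
  show ?case
  proof (cases "x = Leaf \<and> y = Leaf")
    case False
    then show ?thesis
      using 1[OF False refl refl] val_left_right[of x] val_left_right[of y]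
      by (subst lessb.simps) (auto simp: Let_def of_bool_def split: if_splits)
  qed (simp add: lessb.simps)
qed

lemma PFB_less:
  assumes "PF k A" "PF k B" "PFB k C"
  shows "PFB k (\<lambda>e. lessb (A e) (B e) (C e))"
proof -
  let ?a = "\<lambda>e. left (e ! 0) \<noteq> Leaf" and ?b = "\<lambda>e. left (e ! 1) \<noteq> Leaf" and ?c = "\<lambda>e. e ! 2 \<noteq> Leaf"
  let ?Rs = "[\<lambda>e. right (e ! 0), \<lambda>e. right (e ! 1), \<lambda>e. enc_bool (\<not> ?a e \<and> ?b e \<or> ?a e = ?b e \<and> ?c e)]"
  let ?F = "\<lambda>e. enc_bool (lessb (e ! 0) (e ! 1) (e ! 2 \<noteq> Leaf))"
  have "PF 3 ?F"
  proof (rule PF_rec[where C = "\<lambda>e. enc_bool (e ! 0 \<noteq> Leaf \<or> e ! 1 \<noteq> Leaf)"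
        and G = "\<lambda>e. enc_bool (e ! 2 \<noteq> Leaf)" and Rs = ?Rs and H = "\<lambda>e. e ! 0"
        and m = "\<lambda>e. nodes (e ! 0) + nodes (e ! 1)" and q = "[:3:]"])
    show "PF 3 r" if "r \<in> set ?Rs" for r
      using that by (auto intro!: PF_var PF_right PF_left PFB_not PFB_conj PFB_disj PFB_iff PFB_is_Leaf)
  next
    fix e :: "tree list" assume "length e = 3"
    then obtain x y z where e: "e = [x, y, z]" by (auto simp: length_Suc_conv numeral_3_eq_3)
    show "?F e = (if enc_bool (e ! 0 \<noteq> Leaf \<or> e ! 1 \<noteq> Leaf) = Leaf
       then enc_bool (e ! 2 \<noteq> Leaf) else (?F (map (\<lambda>r. r e) ?Rs) # e) ! 0)"
      by (subst lessb.simps) (simp add: e Let_def)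
    assume "enc_bool (e ! 0 \<noteq> Leaf \<or> e ! 1 \<noteq> Leaf) \<noteq> Leaf"
    then have *: "\<not> (x = Leaf \<and> y = Leaf)" by (simp add: e)
    show "nodes (map (\<lambda>r. r e) ?Rs ! 0) + nodes (map (\<lambda>r. r e) ?Rs ! 1) < nodes (e ! 0) + nodes (e ! 1)"
      using nodes_right_pair[OF *] by (simp add: e)
    have "nodes (right x) + (nodes (right y) + nodes (enc_bool b)) \<le> nodes x + (nodes y + nodes z)" for b
      using nodes_right_pair[OF *] nodes_enc_bool_le[of b] nodes_pos[of z] by linarith
    then show "sz (map (\<lambda>r. r e) ?Rs) \<le> sz e" by (simp add: e)
  qed (auto simp: length_Suc_conv numeral_3_eq_3 nodes_enc_bool_le[unfolded numeral_3_eq_3] intro!: PFB_imp PF_var PFB_not PFB_conj PFB_is_Leaf)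
  from PF_comp3[where f = "\<lambda>x y c. enc_bool (lessb x y (c \<noteq> Leaf))", OF this assms]
  show ?thesis by simp
qed

lemma PFB_val_less: "PF k A \<Longrightarrow> PF k B \<Longrightarrow> PFB k (\<lambda>e. val (A e) < val (B e))"
  using PFB_less[OF _ _ PFB_False] by (simp add: less_iff)

lemma PFB_val_eq:
  assumes "PF k A" "PF k B"
  shows "PFB k (\<lambda>e. val (A e) = val (B e))"
proof -
  have *: "val (A e) = val (B e) \<longleftrightarrow> \<not> val (A e) < val (B e) \<and> \<not> val (B e) < val (A e)" for e
    by auto
  show ?thesis unfolding * by (intro PFB_conj PFB_not PFB_val_less assms)
qed

text \<open>Horner's scheme from the most significant digit of \<open>x\<close>:
  \<open>Node Leaf acc\<close> doubles the accumulator.\<close>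

definition mul :: "tree \<Rightarrow> tree \<Rightarrow> tree" where
  "mul x y = foldr (\<lambda>b acc. add (if b = Leaf then Leaf else y) (Node Leaf acc) False) (elems x) Leaf"

lemma mul_simps: "mul Leaf y = Leaf"
  "mul (Node b x) y = add (if b = Leaf then Leaf else y) (Node Leaf (mul x y)) False"
  by (simp_all add: mul_def)

lemma val_mul [simp]: "val (mul x y) = val x * val y"
  by (induction x) (auto simp: mul_simps algebra_simps)

lemma normal_mul [simp]: "normal (mul x y)"
  by (cases x) (auto simp: mul_simps)

text \<open>Each digit of \<open>x\<close> contributes one position for the shift and one for the
  carry.\<close>

lemma len_mul: "len (mul x y) \<le> len y + 2 * len x"
proof (induction x)
  case (Node b x)
  then show ?case
    using len_add[of "if b = Leaf then Leaf else y" "Node Leaf (mul x y)" False]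
    by (auto simp: mul_simps)
qed (simp add: mul_simps)

lemma PF_mul:
  assumes "PF k A" "PF k B"
  shows "PF k (\<lambda>e. mul (A e) (B e))"
proof -
  obtain p where p: "length e = k \<Longrightarrow> nodes (B e) \<le> poly p (sz e)" for e
    using PF_size[OF assms(2)] by blast
  show ?thesis
    unfolding mul_def
  proof (rule PF_foldr[where q = "[:1, 8:] + smult 4 p"])
    fix e ys assume e: "length (e :: tree list) = k"
    let ?x = "lst ys"
    have "nodes (mul ?x (B e)) \<le> 4 * (len (B e) + 2 * len ?x) + 1"
      using nodes_normal[of "mul ?x (B e)"] len_mul[of ?x "B e"] by simp
    also have "\<dots> \<le> 4 * nodes (B e) + 8 * nodes ?x + 1"
      using len_le_nodes[of "B e"] len_le_nodes[of ?x] by simp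
    also have "\<dots> \<le> poly ([:1, 8:] + smult 4 p) (nodes ?x + sz e)"
      using p[OF e] poly_nat_mono[of "sz e" "nodes ?x + sz e" p] by simp
    finally show "nodes (foldr (\<lambda>b acc. add (if b = Leaf then Leaf else B e) (Node Leaf acc) False) ys Leaf)
       \<le> poly ([:1, 8:] + smult 4 p) (nodes (lst ys) + sz e)"
      by (simp add: mul_def)
  qed (intro PF_elems PF_add PF_IfLeaf PF_Leaf PF_vars PF_Node PFB_False assms
      PF_weaken[OF PF_weaken[OF assms(2)]]; simp)+
qed

section \<open>Weights\<close>

text \<open>An item is an edge together with its weight, as in the encoding of the input. Total weights
  are computed as fractions \<open>(p - n) / d\<close> of natural numbers that are not reduced. A denominator 0,
  which the encoding never produces, is read as 1.\<close>

definition wneg :: "tree \<Rightarrow> bool" where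
  "wneg i \<longleftrightarrow> left (left (right i)) \<noteq> Leaf"

definition wnum :: "tree \<Rightarrow> tree" where
  "wnum i = right (left (right i))"

definition wden :: "tree \<Rightarrow> tree" where
  "wden i = (if val (right (right i)) = val Leaf then Node (Node Leaf Leaf) Leaf else right (right i))"

definition weight :: "tree \<Rightarrow> rat" where
  "weight i = (if wneg i then - 1 else 1) * of_nat (val (wnum i)) / of_nat (val (wden i))"

abbreviation wsum :: "tree list \<Rightarrow> rat" where
  "wsum xs \<equiv> sum_list (map weight xs)"

text \<open>The accumulator is \<open>Node (Node p n) d\<close>; keeping positive and negative
  contributions apart avoids subtraction. In every product it supplies the second factor, whose
  length \<open>len_mul\<close> counts only once; otherwise lengths could double in each
  step.\<close>

definition sum_step :: "tree \<Rightarrow> tree \<Rightarrow> tree" where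
  "sum_step i s = Node
     (if wneg i
      then Node (mul (wden i) (left (left s))) (add (mul (wden i) (right (left s))) (mul (wnum i) (right s)) False)
      else Node (add (mul (wden i) (left (left s))) (mul (wnum i) (right s)) False) (mul (wden i) (right (left s))))
     (mul (wden i) (right s))"

definition sum_tree :: "tree list \<Rightarrow> tree" where
  "sum_tree xs = foldr sum_step xs (Node (Node Leaf Leaf) (Node (Node Leaf Leaf) Leaf))"

lemma val_wden_pos: "0 < val (wden i)"
  by (auto simp: wden_def)

lemma sum_tree_simps:
  "sum_tree [] = Node (Node Leaf Leaf) (Node (Node Leaf Leaf) Leaf)"
  "sum_tree (i # xs) = sum_step i (sum_tree xs)"
  by (simp_all add: sum_tree_def)

lemma val_sum_tree:
  "0 < val (right (sum_tree xs)) \<and>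
   wsum xs = (of_nat (val (left (left (sum_tree xs)))) - of_nat (val (right (left (sum_tree xs)))))
     / of_nat (val (right (sum_tree xs)))"
proof (induction xs)
  case (Cons i xs)
  have "of_nat (val (wden i)) \<noteq> (0 :: rat)" "of_nat (val (right (sum_tree xs))) \<noteq> (0 :: rat)"
    using val_wden_pos[of i] Cons by auto
  then show ?case using Cons val_wden_pos[of i]
    by (simp add: sum_tree_simps sum_step_def weight_def field_simps)
qed (simp add: sum_tree_simps)

text \<open>Cross multiplication with the positive denominators, moving the subtracted parts to the
  opposite sides.\<close>

lemma wsum_less_iff:
  "wsum xs < wsum ys \<longleftrightarrow>
   val (add (mul (left (left (sum_tree xs))) (right (sum_tree ys)))
     (mul (right (left (sum_tree ys))) (right (sum_tree xs))) False) <
   val (add (mul (left (left (sum_tree ys))) (right (sum_tree xs)))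
     (mul (right (left (sum_tree xs))) (right (sum_tree ys))) False)"
proof -
  let ?s = "sum_tree xs" and ?t = "sum_tree ys"
  let ?p = "rat_of_nat (val (left (left ?s)))" and ?n = "rat_of_nat (val (right (left ?s)))"
    and ?d = "rat_of_nat (val (right ?s))" and ?p' = "rat_of_nat (val (left (left ?t)))"
    and ?n' = "rat_of_nat (val (right (left ?t)))" and ?d' = "rat_of_nat (val (right ?t))"
  have d: "0 < ?d" "0 < ?d'" using val_sum_tree by auto
  have "wsum xs < wsum ys \<longleftrightarrow> (?p - ?n) / ?d < (?p' - ?n') / ?d'"
    using val_sum_tree by metis
  also have "\<dots> \<longleftrightarrow> ?p * ?d' + ?n' * ?d < ?p' * ?d + ?n * ?d'"
    using d by (simp add: field_simps)
  also have "\<dots> \<longleftrightarrow> rat_of_nat (val (add (mul (left (left ?s)) (right ?t)) (mul (right (left ?t)) (right ?s)) False))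
     < rat_of_nat (val (add (mul (left (left ?t)) (right ?s)) (mul (right (left ?s)) (right ?t)) False))"
    by simp
  finally show ?thesis by (simp only: of_nat_less_iff)
qed

text \<open>Digit counts of products add up, so unreduced fractions stay linear in the input. Each
  of the three entries has at most \<open>1 + 8 * nodes (lst ys)\<close> nodes, and two inner nodes
  hold them together.\<close>

lemma nodes_sum_tree: "nodes (sum_tree ys) \<le> 5 + 24 * nodes (lst ys)"
proof -
  have *: "\<exists>p n d. sum_tree ys = Node (Node p n) d \<and> (\<forall>t\<in>{p, n, d}. normal t \<and> len t \<le> 2 * nodes (lst ys))"
  proof (induction ys)
    case (Cons i ys)
    then obtain p n d where s: "sum_tree ys = Node (Node p n) d"
      "\<And>t. t \<in> {p, n, d} \<Longrightarrow> normal t \<and> len t \<le> 2 * nodes (lst ys)" by blast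
    have "len (wnum i) < nodes i"
      unfolding wnum_def using len_le_nodes[of "right (left (right i))"]
      by (meson le_trans nodes_left_le nodes_right_le order_less_le_trans)
    moreover have "len (right (right i)) < nodes i"
      using len_le_nodes[of "right (right i)"] by (meson le_trans nodes_right_le order_less_le_trans)
    then have "len (wden i) \<le> nodes i" by (auto simp: wden_def Suc_le_eq)
    moreover have "len p \<le> 2 * nodes (lst ys)" "len n \<le> 2 * nodes (lst ys)" "len d \<le> 2 * nodes (lst ys)"
      using s(2) by auto
    ultimately show ?case
      using len_mul[of "wden i" p] len_mul[of "wden i" n] len_mul[of "wden i" d] len_mul[of "wnum i" d]
        len_add[of "mul (wden i) p" "mul (wnum i) d" False] len_add[of "mul (wden i) n" "mul (wnum i) d" False]
      by (auto simp: sum_tree_simps sum_step_def s(1))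
  qed (auto simp: sum_tree_simps)
  then obtain p n d where s: "sum_tree ys = Node (Node p n) d"
    "\<And>t. t \<in> {p, n, d} \<Longrightarrow> normal t \<and> len t \<le> 2 * nodes (lst ys)" by blast
  have "nodes t \<le> 1 + 8 * nodes (lst ys)" if "t \<in> {p, n, d}" for t
    using nodes_normal[of t] s(2)[OF that] by linarith
  from this[of p] this[of n] this[of d] show ?thesis by (simp add: s(1))
qed

lemma PF_sum_tree:
  assumes "PFL k xs"
  shows "PF k (\<lambda>e. sum_tree (xs e))"
proof -
  have 1: "PF (Suc (Suc k)) (\<lambda>e. sum_step (hd e) (hd (tl e)))"
    unfolding sum_step_def wneg_def wnum_def wden_def
    by (intro PF_Node PF_If PFB_not PFB_is_Leaf PF_left PF_right PF_mul PF_add PF_vars PFB_val_eq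
        PF_Leaf PFB_False) auto
  have 2: "PF k (\<lambda>e. Node (Node Leaf Leaf) (Node (Node Leaf Leaf) Leaf))"
    by (intro PF_Node PF_Leaf)
  show ?thesis
    unfolding sum_tree_def
  proof (rule PF_foldr[OF assms 2 1])
    fix e ys
    show "nodes (foldr sum_step ys (Node (Node Leaf Leaf) (Node (Node Leaf Leaf) Leaf)))
        \<le> poly [:5, 24:] (nodes (lst ys) + sz e)"
      using nodes_sum_tree[of ys] by (simp add: sum_tree_def)
  qed
qed

lemma PFB_wsum_less:
  assumes "PFL k xs" "PFL k ys"
  shows "PFB k (\<lambda>e. wsum (xs e) < wsum (ys e))"
  unfolding wsum_less_iff
  by (intro PFB_val_less PF_add PF_mul PF_left PF_right PF_sum_tree assms PFB_False)

text \<open>Starting from \<open>[]\<close> lets the empty solution of weight 0 compete as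
  well.\<close>

definition best_of :: "(tree \<Rightarrow> tree list) \<Rightarrow> tree list \<Rightarrow> tree list" where
  "best_of f xs = foldr (\<lambda>x acc. if wsum acc < wsum (f x) then f x else acc) xs []"

lemma best_of_cases: "best_of f xs = [] \<or> best_of f xs \<in> f ` set xs"
  unfolding best_of_def by (induction xs) auto

lemma best_of_ge: "x \<in> set xs \<Longrightarrow> wsum (f x) \<le> wsum (best_of f xs)"
  unfolding best_of_def by (induction xs) auto

text \<open>The accumulator is always empty or a single candidate, so sizes do not build up over the
  loop.\<close>

lemma PFL_best_of:
  assumes "PFL k xs" and f: "PFL (Suc k) (\<lambda>e. f (hd e) (tl e))"
  shows "PFL k (\<lambda>e. best_of (\<lambda>x. f x e) (xs e))"
proof -
  obtain p where p: "length e = Suc k \<Longrightarrow> nodes (lst (f (hd e) (tl e))) \<le> poly p (sz e)" for e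
    using PF_size[OF f] by blast
  show ?thesis
    unfolding best_of_def
  proof (rule PFL_foldr[OF assms(1) PFL_Nil, where q = "1 + p"])
    fix e ys assume e: "length (e :: tree list) = k"
    let ?b = "foldr (\<lambda>x acc. if wsum acc < wsum (f x e) then f x e else acc) ys []"
    have "?b = [] \<or> ?b \<in> (\<lambda>x. f x e) ` set ys"
      using best_of_cases[of "\<lambda>x. f x e" ys] unfolding best_of_def .
    then show "nodes (lst ?b) \<le> poly (1 + p) (nodes (lst ys) + sz e)"
    proof (elim disjE imageE)
      fix y assume "?b = f y e" and y: "y \<in> set ys"
      then have "nodes (lst ?b) \<le> poly p (nodes y + sz e)"
        using p[of "y # e"] e by simp
      also have "\<dots> \<le> poly p (nodes (lst ys) + sz e)"
        using nodes_mem_lst[OF y] by (intro poly_nat_mono) simp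
      finally show ?thesis by simp
    qed simp
  qed (intro PFL_If PFB_wsum_less PF_elems PF_vars PF_weaken_snd[OF f]; simp)
qed

section \<open>Independent sets in graphs without two separate paths\<close>

text \<open>In this section T is the reflexive closure of the adjacency relation of a graph.
  For such T, \<open>bent T v a b\<close> says that v, a, b induce a path on three vertices in which v is
  adjacent to a. Thus a cluster induces a disjoint union of cliques.\<close>

definition bent :: "('a \<Rightarrow> 'a \<Rightarrow> bool) \<Rightarrow> 'a \<Rightarrow> 'a \<Rightarrow> 'a \<Rightarrow> bool" where
  "bent T v a b \<longleftrightarrow> T v a \<and> T v b \<noteq> T a b"

definition cluster :: "('a \<Rightarrow> 'a \<Rightarrow> bool) \<Rightarrow> 'a set \<Rightarrow> bool" where
  "cluster T S \<longleftrightarrow> (\<forall>v\<in>S. \<forall>a\<in>S. \<forall>b\<in>S. \<not> bent T v a b)"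

text \<open>Reflexivity of \<open>T\<close> turns a common vertex into contact, so overlapping paths
  need no separate treatment.\<close>

definition unseparated :: "('a \<Rightarrow> 'a \<Rightarrow> bool) \<Rightarrow> 'a set \<Rightarrow> bool" where
  "unseparated T S \<longleftrightarrow> (\<forall>v\<in>S. \<forall>a\<in>S. \<forall>b\<in>S. \<forall>x\<in>S. \<forall>y\<in>S. \<forall>z\<in>S.
     bent T v a b \<and> bent T x y z \<longrightarrow> (\<exists>p\<in>{v, a, b}. \<exists>q\<in>{x, y, z}. T p q))"

definition indep :: "('a \<Rightarrow> 'a \<Rightarrow> bool) \<Rightarrow> 'a set \<Rightarrow> bool" where
  "indep T D \<longleftrightarrow> (\<forall>x\<in>D. \<forall>y\<in>D. T x y \<longrightarrow> x = y)"

abbreviation indep_list :: "('a \<Rightarrow> 'a \<Rightarrow> bool) \<Rightarrow> 'a list \<Rightarrow> bool" where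
  "indep_list T \<equiv> sorted_wrt (\<lambda>x y. \<not> T x y)"

definition extend :: "('a \<Rightarrow> 'a \<Rightarrow> bool) \<Rightarrow> 'a \<Rightarrow> 'a list \<Rightarrow> 'a list" where
  "extend T x A = (if \<exists>a\<in>set A. \<exists>b\<in>set A. bent T x a b then A else x # A)"

definition improve :: "(tree \<Rightarrow> tree \<Rightarrow> bool) \<Rightarrow> tree \<Rightarrow> tree list \<Rightarrow> tree list" where
  "improve T v I = (if wsum I < wsum (v # filter (\<lambda>x. \<not> T x v) I) then v # filter (\<lambda>x. \<not> T x v) I else I)"

text \<open>If A is a cluster, this keeps the heaviest item of each clique whose weight is positive.\<close>

definition heaviest :: "(tree \<Rightarrow> tree \<Rightarrow> bool) \<Rightarrow> tree list \<Rightarrow> tree list" where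
  "heaviest T A = foldr (improve T) A []"

text \<open>Suppose that an independent set D contains v and that its earlier elements lie in a cluster
  A containing a and b, but v, a, b induce a path. Then D meets the cliques of a and b in at most
  one element each, d and d', and all other elements of D are far from v, a and b. Such elements
  form a cluster if there are no two separate paths.\<close>

definition base :: "('a \<Rightarrow> 'a \<Rightarrow> bool) \<Rightarrow> 'a list \<Rightarrow> 'a \<Rightarrow> 'a \<Rightarrow> 'a \<Rightarrow> 'a \<Rightarrow> 'a \<Rightarrow> 'a list" where
  "base T L v a b d d' =
     v # d # d' # filter (\<lambda>x. \<not> T x v \<and> \<not> T x a \<and> \<not> T x b \<and> \<not> T x d \<and> \<not> T x d') L"

definition solve :: "(tree \<Rightarrow> tree \<Rightarrow> bool) \<Rightarrow> tree list \<Rightarrow> tree list \<Rightarrow> tree list" where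
  "solve T L B = heaviest T (foldr (extend T) L B)"

definition solve_bases :: "(tree \<Rightarrow> tree \<Rightarrow> bool) \<Rightarrow> tree list \<Rightarrow> tree list" where
  "solve_bases T L = best_of (\<lambda>v. best_of (\<lambda>a. best_of (\<lambda>b. best_of (\<lambda>d. best_of (\<lambda>d'.
     solve T L (base T L v a b d d')) L) L) L) L) L"

definition mwis :: "(tree \<Rightarrow> tree \<Rightarrow> bool) \<Rightarrow> tree list \<Rightarrow> tree list" where
  "mwis T L = (if wsum (solve T L []) < wsum (solve_bases T L) then solve_bases T L else solve T L [])"

section \<open>Soundness: the computed lists are independent\<close>

lemma improve_indep_list: "indep_list T I \<Longrightarrow> symp T \<Longrightarrow> indep_list T (improve T v I)"
  by (auto simp: improve_def sorted_wrt_filter dest: sympD)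

lemma indep_list_heaviest: "symp T \<Longrightarrow> indep_list T (heaviest T A)"
  unfolding heaviest_def by (induction A) (auto intro: improve_indep_list)

lemma distinct_indep_list: "reflp T \<Longrightarrow> indep_list T xs \<Longrightarrow> distinct xs"
  by (induction xs) (auto dest: reflpD)

lemma set_heaviest: "set (heaviest T A) \<subseteq> set A"
  unfolding heaviest_def by (induction A) (auto simp: improve_def)

lemma set_extend: "set A \<subseteq> set (foldr (extend T) xs A)" "set (foldr (extend T) xs A) \<subseteq> set xs \<union> set A"
  by (induction xs) (auto simp: extend_def)

lemma solve_sound:
  assumes "symp T" "set B \<subseteq> set L"
  shows "indep_list T (solve T L B) \<and> set (solve T L B) \<subseteq> set L"
  using assms set_heaviest[of T "foldr (extend T) L B"] set_extend(2)[of T L B]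
  unfolding solve_def by (auto intro: indep_list_heaviest)

lemma best_of_induct:
  assumes "P []" "\<And>x. x \<in> set xs \<Longrightarrow> P (f x)"
  shows "P (best_of f xs)"
  using best_of_cases[of f xs] assms by auto

text \<open>\<open>improve\<close> removes all neighbours of \<open>v\<close> before inserting it,
  so independence survives whatever list is processed, including the bases of wrong guesses.\<close>

lemma mwis_sound:
  assumes "symp T"
  shows "indep_list T (mwis T L) \<and> set (mwis T L) \<subseteq> set L"
proof -
  have "set (base T L v a b d d') \<subseteq> set L" if "{v, d, d'} \<subseteq> set L" for v a b d d'
    using that by (auto simp: base_def)
  then have "indep_list T (solve_bases T L) \<and> set (solve_bases T L) \<subseteq> set L"
    unfolding solve_bases_def
    by (intro best_of_induct[where P = "\<lambda>I. indep_list T I \<and> set I \<subseteq> set L"] solve_sound assms) auto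
  then show ?thesis
    using solve_sound[OF assms, of "[]" L] by (auto simp: mwis_def)
qed

section \<open>Optimality on clusters, and covering independent sets by clusters\<close>

lemma wsum_filter: "wsum I = wsum (filter P I) + wsum (filter (\<lambda>x. \<not> P x) I)"
  by (induction I) auto

text \<open>On a cluster \<open>T\<close> is an equivalence relation, so an independent list holds
  at most one item per class. \<open>improve\<close> thus compares \<open>v\<close> with a single
  rival, and domination is inherited by transitivity.\<close>

lemma heaviest_invariant:
  assumes T: "reflp T" "symp T" and "cluster T (set A)"
  shows "(\<forall>y\<in>set (heaviest T A). 0 < weight y) \<and>
    (\<forall>x\<in>set A. 0 < weight x \<longrightarrow> (\<exists>y\<in>set (heaviest T A). T x y \<and> weight x \<le> weight y))"
  using assms(3)
proof (induction A)
  case Nil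
  then show ?case by (simp add: heaviest_def)
next
  case (Cons v A)
  define I where "I = heaviest T A"
  have IA: "set I \<subseteq> set A" by (simp add: I_def set_heaviest)
  have cl: "T x z" if "T x y" "T y z" "x \<in> set (v # A)" "y \<in> set (v # A)" "z \<in> set (v # A)" for x y z
    using Cons.prems that T unfolding cluster_def bent_def by (metis sympD)
  have "cluster T (set A)" using Cons.prems by (auto simp: cluster_def)
  then have IH: "\<And>y. y \<in> set I \<Longrightarrow> 0 < weight y"
    "\<And>x. x \<in> set A \<Longrightarrow> 0 < weight x \<Longrightarrow> \<exists>y\<in>set I. T x y \<and> weight x \<le> weight y"
    using Cons.IH by (auto simp: I_def)
  have h: "heaviest T (v # A) = improve T v I" by (simp add: heaviest_def I_def)
  have vv: "T v v" using T by (simp add: reflpD)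
  consider (none) "filter (\<lambda>x. T x v) I = []" | (one) y where "filter (\<lambda>x. T x v) I = [y]"
    | (more) y z zs where "filter (\<lambda>x. T x v) I = y # z # zs"
    by (metis list.exhaust)
  then show ?case
  proof cases
    case none
    then have "filter (\<lambda>x. \<not> T x v) I = I" by (auto simp: filter_empty_conv intro: filter_True)
    then have imp: "improve T v I = (if 0 < weight v then v # I else I)" by (simp add: improve_def)
    show ?thesis using IH vv by (auto simp: h imp)
  next
    case (one y)
    then have "y \<in> set (filter (\<lambda>x. T x v) I)" by simp
    then have y: "y \<in> set I" "T y v" "T v y" using T(2) by (auto dest: sympD)
    have uniq: "x = y" if "x \<in> set I" "T x v" for x
    proof -
      have "x \<in> set (filter (\<lambda>x. T x v) I)" using that by simp
      then show ?thesis using one by simp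
    qed
    have w: "wsum I = weight y + wsum (filter (\<lambda>x. \<not> T x v) I)"
      using wsum_filter[of I "\<lambda>x. T x v"] one by simp
    show ?thesis
    proof (cases "weight y < weight v")
      case True
      then have imp: "improve T v I = v # filter (\<lambda>x. \<not> T x v) I" by (simp add: improve_def w)
      have "\<exists>z\<in>set (improve T v I). T x z \<and> weight x \<le> weight z" if x: "x \<in> set A" "0 < weight x" for x
      proof -
        obtain z where z: "z \<in> set I" "T x z" "weight x \<le> weight z" using IH(2)[OF x] by blast
        show ?thesis
        proof (cases "T z v")
          case True
          then have "T x v" using cl[of x z v] z x IA by auto
          then show ?thesis using uniq[OF z(1) True] z(3) \<open>weight y < weight v\<close> by (auto simp: imp)
        qed (use z imp in auto)
      qed
      moreover have "0 < weight v" using True IH(1)[OF y(1)] by simp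
      ultimately show ?thesis using IH(1) vv by (auto simp: h imp)
    next
      case False
      then have imp: "improve T v I = I" by (simp add: improve_def w)
      show ?thesis using IH y False by (auto simp: h imp)
    qed
  next
    \<comment> \<open>Two chosen items touching \<open>v\<close> would touch each other by
      transitivity.\<close>
    case more
    have "indep_list T (filter (\<lambda>x. T x v) I)"
      using indep_list_heaviest[OF T(2)] by (simp add: I_def sorted_wrt_filter)
    then have "\<not> T y z" using more by simp
    moreover have "{y, z} \<subseteq> set (filter (\<lambda>x. T x v) I)" using more by simp
    then have "T y v" "T z v" "y \<in> set A" "z \<in> set A" using IA by auto
    ultimately show ?thesis using cl[of y v z] T(2) by (auto dest: sympD)
  qed
qed

text \<open>A charging argument: each positive element of \<open>D\<close> is sent to a chosen item
  of its clique that is at least as heavy. Two elements with the same image would be adjacent, so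
  the map is injective.\<close>

lemma heaviest_optimal:
  assumes T: "reflp T" "symp T" and A: "cluster T (set A)" and D: "indep T D" "D \<subseteq> set A"
  shows "sum weight D \<le> wsum (heaviest T A)"
proof -
  let ?I = "set (heaviest T A)"
  have IA: "?I \<subseteq> set A" by (rule set_heaviest)
  note inv = heaviest_invariant[OF T A]
  have fin: "finite D" using D finite_subset by auto
  let ?D = "{x \<in> D. 0 < weight x}"
  obtain f where f: "\<And>x. x \<in> ?D \<Longrightarrow> f x \<in> ?I \<and> T x (f x) \<and> weight x \<le> weight (f x)"
  proof -
    have "\<forall>x\<in>?D. \<exists>y. y \<in> ?I \<and> T x y \<and> weight x \<le> weight y" using inv D(2) by blast
    from bchoice[OF this] show thesis using that by blast
  qed
  have "inj_on f ?D"
  proof (rule inj_onI)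
    fix x y assume xy: "x \<in> ?D" "y \<in> ?D" "f x = f y"
    then have "T (f x) x" "T (f x) y" using f[OF xy(1)] f[OF xy(2)] T(2) by (auto dest: sympD)
    moreover have "f x \<in> set A" "x \<in> set A" "y \<in> set A" using f[OF xy(1)] xy IA D(2) by auto
    ultimately have "T x y" using A unfolding cluster_def bent_def by blast
    then show "x = y" using D(1) xy by (auto simp: indep_def)
  qed
  have "sum weight D \<le> sum weight ?D"
  proof -
    have "sum weight ?D = (\<Sum>x\<in>D. if 0 < weight x then weight x else 0)"
      using fin by (rule sum.inter_filter)
    moreover have "sum weight D \<le> (\<Sum>x\<in>D. if 0 < weight x then weight x else 0)"
      by (intro sum_mono) auto
    ultimately show ?thesis by simp
  qed
  also have "\<dots> \<le> sum (\<lambda>x. weight (f x)) ?D" using f by (intro sum_mono) blast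
  also have "\<dots> = sum weight (f ` ?D)" using \<open>inj_on f ?D\<close> by (simp add: sum.reindex)
  also have "\<dots> \<le> sum weight ?I" 
  proof (rule sum_mono2)
    show "f ` ?D \<subseteq> ?I" using f by blast
    show "\<And>y. y \<in> ?I - f ` ?D \<Longrightarrow> 0 \<le> weight y" using inv by (meson DiffD1 less_imp_le)
  qed simp
  also have "\<dots> = wsum (heaviest T A)"
  proof -
    have "distinct (heaviest T A)"
      by (rule distinct_indep_list[OF T(1) indep_list_heaviest[OF T(2)]])
    then show ?thesis by (simp add: sum_list_distinct_conv_sum_set)
  qed
  finally show ?thesis .
qed

text \<open>\<open>extend\<close> tests only triples that begin with \<open>x\<close>. A bent triple
  with \<open>x\<close> in another place consists of distinct vertices and can be reordered to begin
  with \<open>x\<close>.\<close>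

lemma cluster_extend:
  assumes T: "reflp T" "symp T" and A: "cluster T (set A)"
  shows "cluster T (set (extend T x A))"
proof (cases "\<exists>a\<in>set A. \<exists>b\<in>set A. bent T x a b")
  case False
  have xx: "T x x" using T(1) by (simp add: reflpD)
  have s: "T p q = T q p" for p q using T(2) by (auto dest: sympD)
  have x: "T x b = T a b" if "a \<in> set A" "b \<in> set A" "T x a" for a b
    using False that unfolding bent_def by blast
  have "\<not> bent T v a b" if vab: "v \<in> set (x # A)" "a \<in> set (x # A)" "b \<in> set (x # A)" for v a b
  proof
    assume bent: "bent T v a b"
    then have 1: "T v a" "T v b \<noteq> T a b" by (auto simp: bent_def)
    consider "v = x" "a = x" | "v = x" "b = x" "a \<in> set A" | "v = x" "a \<in> set A" "b \<in> set A"
      | "v \<in> set A" "a = x" "b = x" | "v \<in> set A" "a = x" "b \<in> set A" | "v \<in> set A" "a \<in> set A" "b = x"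
      | "v \<in> set A" "a \<in> set A" "b \<in> set A"
      using vab by auto
    then show False
    proof cases
      case 1
      with \<open>T v b \<noteq> T a b\<close> show ?thesis by simp
    next
      case 2
      with 1 xx s[of x a] show ?thesis by simp
    next
      case 3
      with 1 x[of a b] show ?thesis by simp
    next
      case 4
      with 1 xx show ?thesis by simp
    next
      case 5
      with 1 x[of v b] s[of v x] show ?thesis by simp
    next
      case 6
      with 1 x[of v a] x[of a v] s[of v x] s[of a x] s[of v a] show ?thesis by auto
    next
      case 7
      with A bent show ?thesis unfolding cluster_def by blast
    qed
  qed
  then have "cluster T (set (x # A))" unfolding cluster_def by blast
  then show ?thesis using False by (simp only: extend_def if_False)
qed (use A in \<open>simp add: extend_def\<close>)

lemma cluster_extends:
  assumes "reflp T" "symp T" "cluster T (set A)"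
  shows "cluster T (set (foldr (extend T) xs A))"
  using assms by (induction xs) (auto intro: cluster_extend)

text \<open>The elements \<open>v\<close>, \<open>d\<close>, \<open>d'\<close> are pairwise
  nonadjacent or equal, and the filtered rest is far from them, so a bent triple would lie inside
  the rest. Being far from \<open>a\<close> and \<open>b\<close> too, it would be separate from the
  path on \<open>v\<close>, \<open>a\<close>, \<open>b\<close>.\<close>

lemma cluster_base:
  assumes T: "reflp T" "symp T" and L: "unseparated T (set L)" "{v, a, b, d, d'} \<subseteq> set L"
    and v: "bent T v a b" "indep T {v, d, d'}"
  shows "cluster T (set (base T L v a b d d'))"
proof -
  have s: "T p q = T q p" for p q using T(2) by (auto dest: sympD)
  let ?Y = "{x \<in> set L. \<not> T x v \<and> \<not> T x a \<and> \<not> T x b \<and> \<not> T x d \<and> \<not> T x d'}" and ?X = "{v, d, d'}"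
  have far2: "\<not> T y x" if "x \<in> ?X" "y \<in> ?Y" for x y using that by auto
  have far: "\<not> T x y" "\<not> T y x" if "x \<in> ?X" "y \<in> ?Y" for x y
    using far2[OF that] s[of x y] by auto
  have "\<not> bent T p q r" if "p \<in> ?X \<union> ?Y" "q \<in> ?X \<union> ?Y" "r \<in> ?X \<union> ?Y" for p q r
  proof
    assume bent: "bent T p q r"
    show False
    proof (cases "p \<in> ?X")
      case True
      then have "q \<in> ?X" using bent that(2) far(1)[of p q] unfolding bent_def by blast
      then have "p = q" using bent True v(2) unfolding bent_def indep_def by blast
      then show False using bent by (simp add: bent_def)
    next
      case False
      then have p: "p \<in> ?Y" using that by blast
      then have q: "q \<in> ?Y" using bent that(2) far(2)[of q p] unfolding bent_def by blast
      show False
      proof (cases "r \<in> ?X")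
        case True
        then show False using bent far[OF True p] far[OF True q] by (simp add: bent_def)
      next
        case False
        then have r: "r \<in> ?Y" using that by blast
        have "v \<in> set L" "a \<in> set L" "b \<in> set L" "p \<in> set L" "q \<in> set L" "r \<in> set L"
          using L(2) p q r by auto
        then obtain x y where "x \<in> {v, a, b}" "y \<in> {p, q, r}" "T x y"
          using L(1) v(1) bent unfolding unseparated_def by meson
        then show False using p q r s[of x y] by auto
      qed
    qed
  qed
  moreover have "set (base T L v a b d d') = ?X \<union> ?Y" by (auto simp: base_def)
  ultimately show ?thesis by (simp add: cluster_def)
qed

text \<open>Induction over the order of insertion. When an element of \<open>D\<close> is refused, a
  base takes over that contains all of \<open>D\<close> met so far, so the previous base can be
  forgotten.\<close>

lemma covering_base:
  assumes T: "reflp T" "symp T" and L: "unseparated T (set L)" and D: "indep T D" "D \<subseteq> set L"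
    and "set xs \<subseteq> set L"
  shows "\<exists>B. (B = [] \<or> (\<exists>v a b d d'. {v, a, b, d, d'} \<subseteq> set L \<and> B = base T L v a b d d')) \<and>
    cluster T (set B) \<and> D \<inter> set xs \<subseteq> set (foldr (extend T) xs B)"
  using assms(6)
proof (induction xs)
  case Nil
  then show ?case by (intro exI[of _ "[]"]) (simp add: cluster_def)
next
  case (Cons x xs)
  then have "set xs \<subseteq> set L" by simp
  from Cons.IH[OF this] obtain B where B: "B = [] \<or> (\<exists>v a b d d'. {v, a, b, d, d'} \<subseteq> set L \<and> B = base T L v a b d d')"
    "cluster T (set B)" "D \<inter> set xs \<subseteq> set (foldr (extend T) xs B)" by (elim exE conjE) (rule that)
  let ?A = "foldr (extend T) xs B"
  have A: "cluster T (set ?A)" by (rule cluster_extends[OF T B(2)])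
  have AL: "set ?A \<subseteq> set L"
  proof -
    have "set B \<subseteq> set L" using B(1) by (elim disjE exE) (auto simp: base_def)
    then show ?thesis using set_extend(2)[of T xs B] Cons.prems by auto
  qed
  show ?case
  proof (cases "x \<in> D \<and> (\<exists>a\<in>set ?A. \<exists>b\<in>set ?A. bent T x a b)")
    case False
    then have "x \<in> D \<Longrightarrow> extend T x ?A = x # ?A" unfolding extend_def by auto
    then have "D \<inter> set (x # xs) \<subseteq> set (foldr (extend T) (x # xs) B)"
      using B(3) set_extend(1)[of ?A T "[x]"] by auto
    then show ?thesis using B(1,2) by (intro exI[of _ B] conjI)
  next
    case True
    then obtain a b where ab: "a \<in> set ?A" "b \<in> set ?A" "bent T x a b" by blast
    \<comment> \<open>By transitivity on the cluster, at most one element of \<open>D\<close> among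
      \<open>xs\<close> lies in the clique of \<open>c\<close>. If there is none, \<open>x\<close>
      serves as a dummy.\<close>
    have near: "\<exists>d\<in>D. \<forall>y\<in>D \<inter> set xs. T y c \<longrightarrow> y = d" if c: "c \<in> set ?A" for c
    proof (cases "\<exists>d\<in>D \<inter> set xs. T d c")
      case d: True
      then obtain d where d: "d \<in> D" "d \<in> set xs" "T d c" by blast
      have "y = d" if y: "y \<in> D" "y \<in> set xs" "T y c" for y
      proof -
        have "d \<in> set ?A" "y \<in> set ?A" using d y B(3) by auto
        then have "\<not> bent T c d y" using A c unfolding cluster_def by blast
        then have "T d y" using sympD[OF T(2) d(3)] sympD[OF T(2) y(3)] by (simp add: bent_def)
        then show ?thesis using D(1) d(1) y(1) by (auto simp: indep_def)
      qed
      then show ?thesis using d(1) by auto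
    qed (use True in auto)
    obtain d where d: "d \<in> D" "\<And>y. y \<in> D \<Longrightarrow> y \<in> set xs \<Longrightarrow> T y a \<Longrightarrow> y = d"
      using near[OF ab(1)] by auto
    obtain d' where d': "d' \<in> D" "\<And>y. y \<in> D \<Longrightarrow> y \<in> set xs \<Longrightarrow> T y b \<Longrightarrow> y = d'"
      using near[OF ab(2)] by auto
    let ?B = "base T L x a b d d'"
    have sub: "{x, a, b, d, d'} \<subseteq> set L" using True ab AL D(2) d(1) d'(1) by auto
    have "D \<inter> set (x # xs) \<subseteq> set ?B"
    proof
      fix y assume y: "y \<in> D \<inter> set (x # xs)"
      show "y \<in> set ?B"
      proof (cases "y \<in> {x, d, d'}")
        case False
        have "y \<in> D" "x \<in> D" using y True by auto
        then have "\<not> T y x" "\<not> T y d" "\<not> T y d'"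
          using D(1) False d(1) d'(1) unfolding indep_def by blast+
        moreover have "y \<in> set xs" "y \<in> set L" using y False D(2) by auto
        ultimately show ?thesis
          using \<open>y \<in> D\<close> False d(2)[of y] d'(2)[of y] by (auto simp: base_def)
      qed (auto simp: base_def)
    qed
    moreover have "cluster T (set ?B)"
      using cluster_base[OF T L sub ab(3)] D(1) True d(1) d'(1) unfolding indep_def by blast
    ultimately show ?thesis using sub set_extend(1)[of ?B T "x # xs"]
      by (intro exI[of _ ?B] conjI disjI2 exI[of _ x] exI[of _ a] exI[of _ b] exI[of _ d] exI[of _ d'])
        (auto simp del: foldr.simps)
  qed
qed

lemma mwis_optimal:
  assumes T: "reflp T" "symp T" and L: "unseparated T (set L)" and D: "indep T D" "D \<subseteq> set L"
  shows "sum weight D \<le> wsum (mwis T L)"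
proof -
  from covering_base[OF T L D order_refl] obtain B where B: "B = [] \<or> (\<exists>v a b d d'. {v, a, b, d, d'} \<subseteq> set L \<and> B = base T L v a b d d')"
    "cluster T (set B)" "D \<inter> set L \<subseteq> set (foldr (extend T) L B)"
    by (elim exE conjE) (rule that)
  have "sum weight D \<le> wsum (solve T L B)"
    unfolding solve_def using B(3) D
    by (intro heaviest_optimal[OF T cluster_extends[OF T B(2)] D(1)]) auto
  moreover have "wsum (solve T L B) \<le> wsum (mwis T L)"
    using B(1)
  proof
    assume "\<exists>v a b d d'. {v, a, b, d, d'} \<subseteq> set L \<and> B = base T L v a b d d'"
    then obtain v a b d d' where B: "{v, a, b, d, d'} \<subseteq> set L" "B = base T L v a b d d'" by (elim exE conjE)
    let ?s = "\<lambda>v a b d d'. solve T L (base T L v a b d d')"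
    have "wsum (?s v a b d d') \<le> wsum (best_of (?s v a b d) L)"
      using B(1) best_of_ge[of d' L "?s v a b d"] by simp
    also have "\<dots> \<le> wsum (best_of (\<lambda>d. best_of (?s v a b d) L) L)"
      using B(1) best_of_ge[of d L "\<lambda>d. best_of (?s v a b d) L"] by simp
    also have "\<dots> \<le> wsum (best_of (\<lambda>b. best_of (\<lambda>d. best_of (?s v a b d) L) L) L)"
      using B(1) best_of_ge[of b L "\<lambda>b. best_of (\<lambda>d. best_of (?s v a b d) L) L"] by simp
    also have "\<dots> \<le> wsum (best_of (\<lambda>a. best_of (\<lambda>b. best_of (\<lambda>d. best_of (?s v a b d) L) L) L) L)"
      using B(1) best_of_ge[of a L "\<lambda>a. best_of (\<lambda>b. best_of (\<lambda>d. best_of (?s v a b d) L) L) L"] by simp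
    also have "\<dots> \<le> wsum (solve_bases T L)"
      unfolding solve_bases_def
      using B(1) best_of_ge[of v L "\<lambda>v. best_of (\<lambda>a. best_of (\<lambda>b. best_of (\<lambda>d. best_of (?s v a b d) L) L) L) L"]
      by simp
    finally have "wsum (solve T L B) \<le> wsum (solve_bases T L)" unfolding B(2) .
    then show ?thesis by (auto simp: mwis_def)
  qed (auto simp: mwis_def)
  ultimately show ?thesis by simp
qed

section \<open>Forests and induced paths\<close>

lemma simple_graphD:
  assumes "simple_graph G" "{x, y} \<in> edges G"
  shows "x \<noteq> y" "x \<in> verts G" "y \<in> verts G"
  using assms by (auto simp: simple_graph_def doubleton_eq_iff)

lemma simple_graphE:
  assumes "simple_graph G" "e \<in> edges G"
  obtains x y where "e = {x, y}" "x \<noteq> y"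
  using assms by (auto simp: simple_graph_def)

lemma edge_partner:
  assumes "simple_graph G" "e \<in> edges G" "x \<in> e"
  obtains y where "e = {x, y}" "x \<noteq> y"
proof -
  obtain u v where uv: "e = {u, v}" "u \<noteq> v" by (rule simple_graphE[OF assms(1,2)])
  then show thesis using assms(3) that[of u] that[of v] by (auto simp: insert_commute)
qed

text \<open>A core witnesses a cycle without fixing an order of its vertices.\<close>

definition core :: "'a graph \<Rightarrow> 'a set \<Rightarrow> bool" where
  "core G S \<longleftrightarrow> S \<noteq> {} \<and>
     (\<forall>x\<in>S. \<exists>y\<in>S. \<exists>z\<in>S. y \<noteq> z \<and> {x, y} \<in> edges G \<and> {x, z} \<in> edges G)"

lemma core_cycle:
  assumes "is_cycle G vs"
  shows "core G (set vs)"
proof -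
  let ?n = "length vs"
  have n: "?n \<ge> 3" "distinct vs" and E: "\<And>i. i < ?n \<Longrightarrow> {vs ! i, vs ! (Suc i mod ?n)} \<in> edges G"
    using assms unfolding is_cycle_def by blast+
  have "\<exists>y\<in>set vs. \<exists>z\<in>set vs. y \<noteq> z \<and> {vs ! i, y} \<in> edges G \<and> {vs ! i, z} \<in> edges G"
    if i: "i < ?n" for i
  proof -
    let ?j = "Suc i mod ?n"
    \<comment> \<open>The cyclic predecessor of \<open>i\<close>; it differs from the successor
      because the cycle has at least three vertices.\<close>
    define k where "k = (if i = 0 then ?n - 1 else i - 1)"
    have k: "k < ?n" "Suc k mod ?n = i" using i n by (auto simp: k_def)
    have "?j \<noteq> k" using i n by (cases "Suc i = ?n") (auto simp: k_def)
    moreover have j: "?j < ?n" using n(1) by (intro mod_less_divisor) linarith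
    ultimately have "vs ! ?j \<noteq> vs ! k" using k n by (simp add: nth_eq_iff_index_eq)
    moreover have "{vs ! i, vs ! k} \<in> edges G" using E[OF k(1)] k(2) by (simp add: insert_commute)
    ultimately show ?thesis using E[OF i] nth_mem[OF j] nth_mem[OF k(1)] by blast
  qed
  moreover have "set vs \<noteq> {}" using n by auto
  ultimately show ?thesis unfolding core_def by (metis in_set_conv_nth)
qed

text \<open>A longest path in \<open>S\<close> cannot be extended at its first vertex, so two
  neighbours of that vertex lie on the path; cutting behind the farther one yields a cycle.\<close>

lemma cycle_of_core:
  assumes G: "simple_graph G" and S: "core G S" "S \<subseteq> verts G"
  shows "\<exists>vs. is_cycle G vs \<and> set vs \<subseteq> S"
proof -
  have fin: "finite S" using G S finite_subset by (auto simp: simple_graph_def)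
  define path where "path p \<longleftrightarrow> p \<noteq> [] \<and> distinct p \<and> set p \<subseteq> S \<and>
    (\<forall>i. Suc i < length p \<longrightarrow> {p ! i, p ! Suc i} \<in> edges G)" for p
  obtain s where "s \<in> S" using S by (auto simp: core_def)
  then have "path [s]" by (simp add: path_def)
  moreover have "\<forall>p. path p \<longrightarrow> length p \<le> card S"
    unfolding path_def by (metis card_mono distinct_card fin)
  ultimately have "\<exists>p. path p \<and> (\<forall>q. path q \<longrightarrow> length q \<le> length p)"
    using ex_has_greatest_nat[of path "[s]" length "Suc (card S)"] by (simp add: le_imp_less_Suc)
  then obtain p where p0: "path p" and max: "\<And>q. path q \<Longrightarrow> length q \<le> length p" by blast
  have p: "p \<noteq> []" "distinct p" "set p \<subseteq> S" "\<And>i. Suc i < length p \<Longrightarrow> {p ! i, p ! Suc i} \<in> edges G"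
    using p0 by (auto simp: path_def)
  let ?x = "p ! 0"
  have "?x \<in> S" using p(1,3) nth_mem[of 0 p] by blast
  then obtain y z where yz: "y \<in> S" "z \<in> S" "y \<noteq> z" "{?x, y} \<in> edges G" "{?x, z} \<in> edges G"
    using S unfolding core_def by blast
  have on_path: "\<exists>i. 0 < i \<and> i < length p \<and> v = p ! i" if v: "v \<in> S" "{?x, v} \<in> edges G" for v
  proof -
    have "v \<in> set p"
    proof (rule ccontr)
      assume "v \<notin> set p"
      moreover have "{(v # p) ! i, (v # p) ! Suc i} \<in> edges G" if "Suc i < length (v # p)" for i
        using that p(1,4) v by (cases i) (auto simp: insert_commute)
      ultimately have "path (v # p)" using p v unfolding path_def by simp
      then show False using max[of "v # p"] by simp
    qed
    then obtain i where "i < length p" "v = p ! i" by (metis in_set_conv_nth)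
    moreover have "i \<noteq> 0" using simple_graphD(1)[OF G v(2)] calculation(2) by (intro notI) simp
    ultimately show ?thesis by auto
  qed
  obtain i j where ij: "0 < i" "i < length p" "y = p ! i" "0 < j" "j < length p" "z = p ! j"
    using on_path[OF yz(1,4)] on_path[OF yz(2,5)] by blast
  \<comment> \<open>The two neighbours have distinct positive positions, so the larger is at least 2
    and the cycle has at least three vertices.\<close>
  define m where "m = max i j"
  have m: "2 \<le> m" "m < length p" 
  proof -
    have "i \<noteq> j" using ij yz(3) by auto
    then show "2 \<le> m" "m < length p" using ij by (auto simp: m_def)
  qed
  have xm: "{p ! m, ?x} \<in> edges G" using ij yz by (auto simp: m_def max_def insert_commute)
  let ?c = "take (Suc m) p"
  have "{?c ! i, ?c ! (Suc i mod length ?c)} \<in> edges G" if "i < length ?c" for i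
  proof (cases "i = m")
    case True
    then show ?thesis using m xm by simp
  next
    case False
    then show ?thesis using that m p(4)[of i] by simp
  qed
  then have "is_cycle G ?c"
    using m p(2) order_trans[OF set_take_subset order_trans[OF p(3) S(2)], of "Suc m"]
    by (auto simp: is_cycle_def)
  moreover have "set ?c \<subseteq> S" using p(3) by (meson set_take_subset order_trans)
  ultimately show ?thesis by blast
qed

lemma is_cycle_induced: "is_cycle (induced_subgraph G U) vs \<longleftrightarrow> is_cycle G vs \<and> set vs \<subseteq> U"
proof -
  have "vs ! (Suc i mod length vs) \<in> set vs" if "i < length vs" for i
    using that by (intro nth_mem mod_less_divisor) linarith
  then show ?thesis by (auto simp: is_cycle_def induced_subgraph_def)
qed

lemma forest_induced_iff:
  assumes "simple_graph G" "U \<subseteq> verts G"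
  shows "forest (induced_subgraph G U) \<longleftrightarrow> \<not> (\<exists>S\<subseteq>U. core G S)"
  unfolding forest_def is_cycle_induced using assms core_cycle cycle_of_core by (metis order_trans)

section \<open>Induced three-vertex paths and contact between edges\<close>

definition induces_P3 :: "'a graph \<Rightarrow> 'a \<Rightarrow> 'a \<Rightarrow> 'a \<Rightarrow> bool" where
  "induces_P3 G a b c \<longleftrightarrow> a \<noteq> c \<and> {a, b} \<in> edges G \<and> {b, c} \<in> edges G \<and> {a, c} \<notin> edges G"

lemma verts_two_P3: "verts two_P3 = {Inl 0, Inl 1, Inl 2, Inr 0, Inr 1, Inr 2}"
  by (auto simp: two_P3_def disjoint_union_def path_graph_def lessThan_nat_numeral lessThan_Suc numeral_3_eq_3)

lemma edges_two_P3:
  "edges two_P3 = {{Inl 0, Inl 1}, {Inl 1, Inl 2}, {Inr 0, Inr 1}, {Inr 1, Inr 2}}"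
proof -
  have "edges (path_graph 3) = {{0, 1}, {1, 2}}"
  proof -
    have "Suc i < 3 \<longleftrightarrow> i = 0 \<or> i = 1" for i by auto
    then show ?thesis by (auto simp: path_graph_def numeral_2_eq_2)
  qed
  then show ?thesis by (auto simp: two_P3_def disjoint_union_def)
qed

text \<open>Otherwise the six vertices are distinct, and numbering them along the two paths is an
  isomorphism onto \<open>two_P3\<close>.\<close>

lemma two_P3_free_joined:
  assumes G: "simple_graph G" "free_of two_P3 G"
    and P: "induces_P3 G a b c" and Q: "induces_P3 G a' b' c'"
  shows "\<exists>x\<in>{a, b, c}. \<exists>y\<in>{a', b', c'}. x = y \<or> {x, y} \<in> edges G"
proof (rule ccontr)
  assume "\<not> ?thesis"
  then have sep: "x \<noteq> y" "{x, y} \<notin> edges G" "{y, x} \<notin> edges G"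
    if "x \<in> {a, b, c}" "y \<in> {a', b', c'}" for x y
    using that by (auto simp: insert_commute)
  have loop: "{x} \<notin> edges G" for x using simple_graphD(1)[OF G(1), of x x] by auto
  have V: "{a, b, c, a', b', c'} \<subseteq> verts G" and ne: "a \<noteq> b" "b \<noteq> c" "a \<noteq> c" "a' \<noteq> b'" "b' \<noteq> c'" "a' \<noteq> c'"
    using P Q simple_graphD[OF G(1)] by (auto simp: induces_P3_def)
  have E: "{a, b} \<in> edges G" "{b, a} \<in> edges G" "{b, c} \<in> edges G" "{c, b} \<in> edges G"
    "{a, c} \<notin> edges G" "{c, a} \<notin> edges G"
    "{a', b'} \<in> edges G" "{b', a'} \<in> edges G" "{b', c'} \<in> edges G" "{c', b'} \<in> edges G"
    "{a', c'} \<notin> edges G" "{c', a'} \<notin> edges G"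
    using P Q by (auto simp: induces_P3_def insert_commute)
  let ?S = "{a, b, c, a', b', c'}"
  have d: "a \<noteq> a'" "a \<noteq> b'" "a \<noteq> c'" "b \<noteq> a'" "b \<noteq> b'" "b \<noteq> c'" "c \<noteq> a'" "c \<noteq> b'" "c \<noteq> c'"
    by (rule sep; simp)+
  have N: "{x, y} \<notin> edges G \<and> {y, x} \<notin> edges G" if "x \<in> {a, b, c}" "y \<in> {a', b', c'}" for x y
    using sep(2,3)[OF that] by simp
  have N': "{a, a'} \<notin> edges G \<and> {a', a} \<notin> edges G" "{a, b'} \<notin> edges G \<and> {b', a} \<notin> edges G"
    "{a, c'} \<notin> edges G \<and> {c', a} \<notin> edges G" "{b, a'} \<notin> edges G \<and> {a', b} \<notin> edges G"
    "{b, b'} \<notin> edges G \<and> {b', b} \<notin> edges G" "{b, c'} \<notin> edges G \<and> {c', b} \<notin> edges G"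
    "{c, a'} \<notin> edges G \<and> {a', c} \<notin> edges G" "{c, b'} \<notin> edges G \<and> {b', c} \<notin> edges G"
    "{c, c'} \<notin> edges G \<and> {c', c} \<notin> edges G"
    by (rule N; simp)+
  obtain f :: "'a \<Rightarrow> nat + nat" where f: "f a = Inl 0" "f b = Inl 1" "f c = Inl 2" "f a' = Inr 0" "f b' = Inr 1" "f c' = Inr 2"
  proof
    let ?f = "\<lambda>x. if x = a then Inl 0 else if x = b then Inl 1 else if x = c then Inl 2
      else if x = a' then Inr 0 else if x = b' then Inr 1 else Inr (2 :: nat) :: nat + nat"
    show "?f a = Inl 0" "?f b = Inl 1" "?f c = Inl 2" "?f a' = Inr 0" "?f b' = Inr 1" "?f c' = Inr 2"
      using ne d by simp_all
  qed
  have "bij_betw f ?S (verts two_P3)"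
    unfolding bij_betw_def verts_two_P3
  proof
    show "inj_on f ?S" unfolding inj_on_def ball_simps f by simp
    show "f ` ?S = {Inl 0, Inl 1, Inl 2, Inr 0, Inr 1, Inr 2}" unfolding image_insert f by simp
  qed
  moreover have "{u, v} \<in> edges (induced_subgraph G ?S) \<longleftrightarrow> {f u, f v} \<in> edges two_P3"
    if uv: "u \<in> ?S" "v \<in> ?S" for u v
  proof -
    have "\<forall>u\<in>?S. \<forall>v\<in>?S. {u, v} \<in> edges G \<longleftrightarrow> {f u, f v} \<in> edges two_P3"
      unfolding ball_simps f edges_two_P3
      by (simp add: E N' loop doubleton_eq_iff)
    then have "{u, v} \<in> edges G \<longleftrightarrow> {f u, f v} \<in> edges two_P3" using uv by blast
    moreover have "{u, v} \<subseteq> ?S" using uv by simp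
    ultimately show ?thesis by (simp only: induced_subgraph_def snd_conv mem_Collect_eq simp_thms)
  qed
  moreover have "verts (induced_subgraph G ?S) = ?S"
    using V by (auto simp: induced_subgraph_def)
  ultimately have "isomorphic (induced_subgraph G ?S) two_P3"
    unfolding isomorphic_def by (intro exI[of _ f]) simp
  then show False using G(2) V unfolding free_of_def by blast
qed

text \<open>This is the fact that a graph without induced three-vertex paths is a disjoint union of
  cliques.\<close>

lemma no_P3_trans:
  assumes "\<And>a b c. {a, b, c} \<subseteq> U \<Longrightarrow> \<not> induces_P3 G a b c"
    and "{x, y, z} \<subseteq> U" "x = y \<or> {x, y} \<in> edges G" "y = z \<or> {y, z} \<in> edges G"
  shows "x = z \<or> {x, z} \<in> edges G"
  using assms(1)[OF assms(2)] assms(3,4) by (auto simp: induces_P3_def)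

definition joined :: "'a graph \<Rightarrow> 'a set \<Rightarrow> 'a set \<Rightarrow> bool" where
  "joined G e f \<longleftrightarrow> (\<exists>x\<in>e. \<exists>y\<in>f. x = y \<or> {x, y} \<in> edges G)"

text \<open>For disjoint edges, distinct pairs are distinct connecting edges, and two of these close
  a cycle of length three or four. Distinct crowded edges thus never occur together in an acyclic
  matching.\<close>

definition crowded :: "'a graph \<Rightarrow> 'a set \<Rightarrow> 'a set \<Rightarrow> bool" where
  "crowded G e f \<longleftrightarrow> e \<inter> f \<noteq> {} \<or>
     (\<exists>x\<in>e. \<exists>y\<in>f. \<exists>x'\<in>e. \<exists>y'\<in>f. (x, y) \<noteq> (x', y') \<and> {x, y} \<in> edges G \<and> {x', y'} \<in> edges G)"

lemma joined_sym: "joined G e f \<longleftrightarrow> joined G f e"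
  unfolding joined_def by (metis insert_commute)

lemma crowdedI:
  "x \<in> e \<Longrightarrow> y \<in> f \<Longrightarrow> x' \<in> e \<Longrightarrow> y' \<in> f \<Longrightarrow> (x, y) \<noteq> (x', y') \<Longrightarrow>
   {x, y} \<in> edges G \<Longrightarrow> {x', y'} \<in> edges G \<Longrightarrow> crowded G e f"
  unfolding crowded_def by blast

lemma crowded_sym: "crowded G e f \<Longrightarrow> crowded G f e"
proof -
  assume "crowded G e f"
  then consider "e \<inter> f \<noteq> {}" | x y x' y' where "x \<in> e" "y \<in> f" "x' \<in> e" "y' \<in> f" "(x, y) \<noteq> (x', y')"
    "{x, y} \<in> edges G" "{x', y'} \<in> edges G" unfolding crowded_def by blast
  then show ?thesis
  proof cases
    case 2
    then have "(y, x) \<noteq> (y', x')" "{y, x} \<in> edges G" "{y', x'} \<in> edges G" by (auto simp: insert_commute)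
    with 2 show ?thesis unfolding crowded_def by blast
  qed (auto simp: crowded_def)
qed

text \<open>Each edge lies within one clique of the subgraph on \<open>U\<close>, and contact merges
  the two cliques into one.\<close>

lemma no_P3_joined_all:
  assumes G: "simple_graph G" and U: "\<And>a b c. {a, b, c} \<subseteq> U \<Longrightarrow> \<not> induces_P3 G a b c"
    and e: "e \<in> edges G" "f \<in> edges G" "e \<union> f \<subseteq> U" "joined G e f" and xy: "x \<in> e" "y \<in> f"
  shows "x = y \<or> {x, y} \<in> edges G"
proof -
  obtain x' y' where x'y': "x' \<in> e" "y' \<in> f" "x' = y' \<or> {x', y'} \<in> edges G"
    using e(4) by (auto simp: joined_def)
  have in_edge: "p = q \<or> {p, q} \<in> edges G" if g: "g \<in> edges G" "p \<in> g" "q \<in> g" for g p q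
  proof -
    obtain r where "g = {p, r}" by (rule edge_partner[OF G g(1,2)])
    then show ?thesis using g by auto
  qed
  have A: "x = y' \<or> {x, y'} \<in> edges G"
    by (rule no_P3_trans[OF U, where y = x']) (use in_edge[OF e(1) xy(1) x'y'(1)] x'y' xy e(3) in auto)
  show ?thesis
    by (rule no_P3_trans[OF U _ A]) (use in_edge[OF e(2) x'y'(2) xy(2)] x'y' xy e(3) in auto)
qed

text \<open>Otherwise all three edges lie in one clique, so \<open>e\<close> and \<open>g\<close>
  are in contact.\<close>

lemma P3_of_chain:
  assumes G: "simple_graph G" and e: "e \<in> edges G" "f \<in> edges G" "g \<in> edges G"
    and J: "joined G e f" "joined G f g" "\<not> joined G e g"
  shows "\<exists>a b c. {a, b, c} \<subseteq> e \<union> f \<union> g \<and> induces_P3 G a b c"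
proof (rule ccontr)
  assume "\<not> ?thesis"
  then have U: "\<And>a b c. {a, b, c} \<subseteq> e \<union> f \<union> g \<Longrightarrow> \<not> induces_P3 G a b c" by blast
  obtain x where x: "x \<in> e" using simple_graphE[OF G e(1)] by blast
  obtain y where y: "y \<in> f" using simple_graphE[OF G e(2)] by blast
  obtain z where z: "z \<in> g" using simple_graphE[OF G e(3)] by blast
  have "x = y \<or> {x, y} \<in> edges G"
    by (rule no_P3_joined_all[where U = "e \<union> f \<union> g", OF G U e(1,2) _ J(1) x y]) auto
  moreover have "y = z \<or> {y, z} \<in> edges G"
    by (rule no_P3_joined_all[where U = "e \<union> f \<union> g", OF G U e(2,3) _ J(2) y z]) auto
  ultimately have "x = z \<or> {x, z} \<in> edges G"
    by (intro no_P3_trans[where U = "e \<union> f \<union> g" and x = x and y = y and z = z, OF U]) (use x y z in auto)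
  then show False using J(3) x z by (auto simp: joined_def)
qed

text \<open>Otherwise both edges lie in one clique and are crowded.\<close>

lemma P3_of_pair:
  assumes G: "simple_graph G" and e: "e \<in> edges G" "f \<in> edges G"
    and J: "joined G e f" "\<not> crowded G e f"
  shows "\<exists>a b c. {a, b, c} \<subseteq> e \<union> f \<and> induces_P3 G a b c"
proof (rule ccontr)
  assume "\<not> ?thesis"
  then have U: "\<And>a b c. {a, b, c} \<subseteq> e \<union> f \<Longrightarrow> \<not> induces_P3 G a b c" by blast
  have adj: "{x, y} \<in> edges G" if "x \<in> e" "y \<in> f" for x y
  proof -
    have "x = y \<or> {x, y} \<in> edges G"
      by (rule no_P3_joined_all[where U = "e \<union> f", OF G U e _ J(1) that]) auto
    moreover have "x \<noteq> y" using J(2) that by (auto simp: crowded_def)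
    ultimately show ?thesis by simp
  qed
  obtain x x' where x: "e = {x, x'}" "x \<noteq> x'" by (rule simple_graphE[OF G e(1)])
  obtain y y' where y: "f = {y, y'}" by (rule simple_graphE[OF G e(2)])
  have "{x, y} \<in> edges G" "{x', y} \<in> edges G" using adj x y by auto
  then show False using J(2) x y crowdedI[of x e y f x' y G] by simp
qed

section \<open>The structure of acyclic matchings\<close>

text \<open>The conflict graph inherits the hypothesis on \<open>G\<close>: by
  \<open>P3_of_chain\<close>, each induced path of three edges contains an induced path of three
  vertices. If \<open>e\<close> and \<open>g\<close> are in contact, \<open>e\<close> is the middle,
  and the chain is read as \<open>g\<close>, \<open>e\<close>, \<open>f\<close>.\<close>

lemma unseparated_joined:
  assumes G: "simple_graph G" "free_of two_P3 G"
  shows "unseparated (joined G) (edges G)"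
proof -
  have P3: "\<exists>a b c. {a, b, c} \<subseteq> e \<union> f \<union> g \<and> induces_P3 G a b c"
    if e: "e \<in> edges G" "f \<in> edges G" "g \<in> edges G" and bent: "bent (joined G) e f g" for e f g
  proof (cases "joined G e g")
    case True
    then have "joined G g e" "joined G e f" "\<not> joined G g f"
      using bent by (auto simp: bent_def joined_sym)
    from P3_of_chain[OF G(1) e(3,1,2) this] show ?thesis by (simp add: Un_ac)
  next
    case False
    then have "joined G e f" "joined G f g" using bent by (auto simp: bent_def)
    from P3_of_chain[OF G(1) e this False] show ?thesis .
  qed
  show ?thesis
    unfolding unseparated_def
  proof (intro ballI impI, elim conjE)
    fix e f g e' f' g'
    assume E: "e \<in> edges G" "f \<in> edges G" "g \<in> edges G" "e' \<in> edges G" "f' \<in> edges G" "g' \<in> edges G"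
      and bent: "bent (joined G) e f g" "bent (joined G) e' f' g'"
    obtain a b c where 1: "{a, b, c} \<subseteq> e \<union> f \<union> g" "induces_P3 G a b c" using P3 E bent by blast
    obtain a' b' c' where 2: "{a', b', c'} \<subseteq> e' \<union> f' \<union> g'" "induces_P3 G a' b' c'" using P3 E bent by blast
    obtain x y where xy: "x \<in> {a, b, c}" "y \<in> {a', b', c'}" "x = y \<or> {x, y} \<in> edges G"
      using two_P3_free_joined[OF G 1(2) 2(2)] by blast
    obtain p where "p \<in> {e, f, g}" "x \<in> p" using xy(1) 1(1) by blast
    moreover obtain q where "q \<in> {e', f', g'}" "y \<in> q" using xy(2) 2(1) by blast
    ultimately show "\<exists>p\<in>{e, f, g}. \<exists>q\<in>{e', f', g'}. joined G p q"
      using xy(3) unfolding joined_def by blast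
  qed
qed

text \<open>Contracting \<open>g\<close> leaves it with degree at least two: either both ends lie in
  the core and each has a neighbour outside \<open>g\<close>, or the only end in the core has
  two.\<close>

lemma core_leaves_edge:
  assumes G: "simple_graph G" and S: "core G S" and g: "g \<in> edges G" "g \<inter> S \<noteq> {}"
  obtains p q u v where "p \<in> g" "q \<in> g" "u \<in> S - g" "v \<in> S - g" "(p, u) \<noteq> (q, v)"
    "{p, u} \<in> edges G" "{q, v} \<in> edges G"
proof -
  obtain x where x: "x \<in> g" "x \<in> S" using g by blast
  obtain y where y: "g = {x, y}" "x \<noteq> y" by (rule edge_partner[OF G g(1) x(1)])
  have nbrs: "\<exists>u\<in>S. \<exists>v\<in>S. u \<noteq> v \<and> {z, u} \<in> edges G \<and> {z, v} \<in> edges G" if "z \<in> S" for z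
    using S that by (simp add: core_def)
  have leave: "\<exists>u\<in>S - g. {z, u} \<in> edges G" if z: "z \<in> S" "z \<in> g" for z
  proof -
    obtain u v where uv: "u \<in> S" "v \<in> S" "u \<noteq> v" "{z, u} \<in> edges G" "{z, v} \<in> edges G"
      using nbrs[OF z(1)] by blast
    have "u \<noteq> z" "v \<noteq> z" using uv simple_graphD(1)[OF G] by blast+
    then have "u \<notin> g \<or> v \<notin> g" using uv(3) z(2) y(1) by auto
    then show ?thesis using uv by blast
  qed
  show thesis
  proof (cases "y \<in> S")
    case True
    obtain u where "u \<in> S - g" "{x, u} \<in> edges G" using leave[OF x(2,1)] by blast
    moreover obtain v where "v \<in> S - g" "{y, v} \<in> edges G" using leave[OF True] y(1) by blast
    ultimately show ?thesis using that[of x y u v] y by simp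
  next
    case False
    obtain u v where uv: "u \<in> S" "v \<in> S" "u \<noteq> v" "{x, u} \<in> edges G" "{x, v} \<in> edges G"
      using nbrs[OF x(2)] by blast
    have "u \<noteq> x" "v \<noteq> x" using uv simple_graphD(1)[OF G] by blast+
    then show ?thesis using that[of x x u v] uv y False by auto
  qed
qed

section \<open>Sufficient conditions for acyclicity of a matching\<close>

lemma matching_verts: "simple_graph G \<Longrightarrow> M \<subseteq> edges G \<Longrightarrow> \<Union> M \<subseteq> verts G"
  by (force simp: simple_graph_def)

lemma acyclic_matchingI:
  assumes G: "simple_graph G" and M: "M \<subseteq> edges G" "\<And>e f. e \<in> M \<Longrightarrow> f \<in> M \<Longrightarrow> e \<noteq> f \<Longrightarrow> e \<inter> f = {}"
    and core: "\<And>S. S \<subseteq> \<Union> M \<Longrightarrow> \<not> core G S"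
  shows "acyclic_matching G M"
  using M core forest_induced_iff[OF G matching_verts[OF G M(1)]]
  by (auto simp: acyclic_matching_def matching_def pairwise_def disjnt_def)

lemma acyclic_matching_of_indep:
  assumes G: "simple_graph G" and M: "M \<subseteq> edges G" "indep (joined G) M"
  shows "acyclic_matching G M"
proof (rule acyclic_matchingI[OF G M(1)])
  have joined: "e = f" if "e \<in> M" "f \<in> M" "joined G e f" for e f
    using M(2) that by (simp add: indep_def)
  show "e \<inter> f = {}" if "e \<in> M" "f \<in> M" "e \<noteq> f" for e f
    using joined[OF that(1,2)] that(3) by (auto simp: joined_def)
  show "\<not> core G S" if S: "S \<subseteq> \<Union> M" for S
  proof
    assume c: "core G S"
    then obtain x where "x \<in> S" by (auto simp: core_def)
    then obtain g where g: "g \<in> M" "g \<inter> S \<noteq> {}" using S by blast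
    obtain p u where "p \<in> g" "u \<in> S - g" "{p, u} \<in> edges G"
      by (rule core_leaves_edge[OF G c _ g(2)]) (use g M in auto)
    moreover then obtain h where "h \<in> M" "u \<in> h" using S by blast
    ultimately show False using joined[OF g(1), of h] by (auto simp: joined_def)
  qed
qed

text \<open>A core meeting \<open>g\<close> in \<open>I\<close> would leave it twice, necessarily
  into \<open>e\<close> and \<open>f\<close>; both exits into one of them make \<open>g\<close>
  crowded, and exits into both make it joined to both. So the core lies in \<open>e\<close> and
  \<open>f\<close>, and leaving one of them twice makes this pair crowded.\<close>

lemma acyclic_matching_of_pair:
  assumes G: "simple_graph G" and I: "I \<subseteq> edges G" "indep (joined G) I"
    and e: "e \<in> edges G" "f \<in> edges G" "\<not> crowded G e f"
    and far: "\<And>g. g \<in> I \<Longrightarrow> \<not> crowded G g e \<and> \<not> crowded G g f \<and> \<not> (joined G g e \<and> joined G g f)"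
  shows "acyclic_matching G (insert e (insert f I))"
proof (rule acyclic_matchingI[OF G])
  let ?M = "insert e (insert f I)"
  show "?M \<subseteq> edges G" using I e by simp
  have joined: "g = h" if "g \<in> I" "h \<in> I" "joined G g h" for g h
    using I(2) that by (simp add: indep_def)
  have dj: "g \<inter> h = {}" if "\<not> crowded G g h" for g h
    using that by (auto simp: crowded_def)
  show "g \<inter> h = {}" if gh: "g \<in> ?M" "h \<in> ?M" "g \<noteq> h" for g h
  proof -
    have "g' \<inter> e = {} \<and> g' \<inter> f = {}" if "g' \<in> I" for g'
      using far[OF that] dj by blast
    moreover have "g \<inter> h = {}" if "g \<in> I" "h \<in> I"
      using joined[OF that] gh(3) by (auto simp: joined_def)
    ultimately show ?thesis using gh dj[OF e(3)] by blast
  qed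
  show "\<not> core G S" if S: "S \<subseteq> \<Union> ?M" for S
  proof
    assume c: "core G S"
    have out: "g \<inter> S = {}" if g: "g \<in> I" for g
    proof (rule ccontr)
      assume "g \<inter> S \<noteq> {}"
      then obtain p q u v where pq: "p \<in> g" "q \<in> g" "u \<in> S - g" "v \<in> S - g" "(p, u) \<noteq> (q, v)"
        "{p, u} \<in> edges G" "{q, v} \<in> edges G"
        using core_leaves_edge[OF G c] g I(1) by blast
      have ef: "w \<in> e \<union> f" if wr: "w \<in> S - g" "r \<in> g" "{r, w} \<in> edges G" for w r
      proof (rule ccontr)
        assume "w \<notin> e \<union> f"
        then obtain h where "h \<in> I" "w \<in> h" using S wr(1) by blast
        then show False using joined[OF g, of h] wr by (auto simp: joined_def)
      qed
      have "u \<in> e \<union> f" "v \<in> e \<union> f" using ef pq by blast+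
      moreover have "\<not> (u \<in> e \<and> v \<in> e)" "\<not> (u \<in> f \<and> v \<in> f)"
        using far[OF g] crowdedI[OF pq(1) _ pq(2) _ pq(5-7)] by blast+
      moreover have "joined G g h" if "w \<in> h" "r \<in> g" "{r, w} \<in> edges G" for w r h
        using that by (auto simp: joined_def)
      ultimately show False using far[OF g] pq by (metis UnE)
    qed
    \<comment> \<open>The symmetric condition on \<open>g \<union> h\<close> lets this serve for
      \<open>e\<close> and for \<open>f\<close>.\<close>
    have pair: "g \<inter> S = {}"
      if g: "g \<in> edges G" "\<not> crowded G g h" "g \<union> h = e \<union> f" for g h
    proof (rule ccontr)
      assume "g \<inter> S \<noteq> {}"
      then obtain p q u v where pq: "p \<in> g" "q \<in> g" "u \<in> S - g" "v \<in> S - g" "(p, u) \<noteq> (q, v)"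
        "{p, u} \<in> edges G" "{q, v} \<in> edges G"
        using core_leaves_edge[OF G c g(1)] by blast
      have "u \<in> h" "v \<in> h" using pq(3,4) S out g(3) by blast+
      then show False using g(2) crowdedI[OF pq(1) _ pq(2) _ pq(5-7)] by blast
    qed
    have "e \<inter> S = {}" "f \<inter> S = {}"
      using pair[OF e(1,3)] pair[of f e] e crowded_sym[of G f e] by auto
    then have "S = {}" using S out by blast
    then show False using c by (simp add: core_def)
  qed
qed

section \<open>Necessary conditions for acyclicity of a matching\<close>

lemma acyclic_matchingD:
  assumes G: "simple_graph G" and M: "acyclic_matching G M"
  shows "M \<subseteq> edges G" "\<And>e f. e \<in> M \<Longrightarrow> f \<in> M \<Longrightarrow> e \<noteq> f \<Longrightarrow> e \<inter> f = {}" "\<And>S. S \<subseteq> \<Union> M \<Longrightarrow> \<not> core G S"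
proof -
  show 1: "M \<subseteq> edges G" using M by (simp add: acyclic_matching_def matching_def)
  show "\<And>S. S \<subseteq> \<Union> M \<Longrightarrow> \<not> core G S"
    using M forest_induced_iff[OF G matching_verts[OF G 1]] by (auto simp: acyclic_matching_def)
  show "\<And>e f. e \<in> M \<Longrightarrow> f \<in> M \<Longrightarrow> e \<noteq> f \<Longrightarrow> e \<inter> f = {}"
    using M by (auto simp: acyclic_matching_def matching_def pairwise_def disjnt_def)
qed

text \<open>Two connecting edges close a triangle if they share an end, and otherwise a cycle of
  length four.\<close>

lemma acyclic_matching_not_crowded:
  assumes G: "simple_graph G" and M: "acyclic_matching G M" and e: "e \<in> M" "f \<in> M" "e \<noteq> f"
  shows "\<not> crowded G e f"
proof
  note MD = acyclic_matchingD[OF G M]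
  have E: "e \<in> edges G" "f \<in> edges G" using e MD(1) by auto
  assume "crowded G e f"
  then obtain x y x' y' where xy: "x \<in> e" "y \<in> f" "x' \<in> e" "y' \<in> f" "(x, y) \<noteq> (x', y')"
    "{x, y} \<in> edges G" "{x', y'} \<in> edges G"
    using MD(2)[OF e] unfolding crowded_def by blast
  have comm: "{y, x} \<in> edges G" "{y', x'} \<in> edges G" using xy by (simp_all add: insert_commute)
  have "x \<noteq> y" "x \<noteq> y'" "x' \<noteq> y" "x' \<noteq> y'" using xy MD(2)[OF e] by auto
  have "core G {x, x', y, y'}"
  proof -
    have ex: "{x, x'} \<in> edges G \<and> {x', x} \<in> edges G" if "x \<noteq> x'"
    proof -
      obtain z where "e = {x, z}" by (rule edge_partner[OF G E(1) xy(1)])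
      then have "e = {x, x'}" using xy(3) that by auto
      then show ?thesis using E(1) by (simp add: insert_commute)
    qed
    have fy: "{y, y'} \<in> edges G \<and> {y', y} \<in> edges G" if "y \<noteq> y'"
    proof -
      obtain z where "f = {y, z}" by (rule edge_partner[OF G E(2) xy(2)])
      then have "f = {y, y'}" using xy(4) that by auto
      then show ?thesis using E(2) by (simp add: insert_commute)
    qed
    consider "x = x'" "y \<noteq> y'" | "x \<noteq> x'" "y = y'" | "x \<noteq> x'" "y \<noteq> y'" using xy(5) by auto
    then show ?thesis
    proof cases
      case 1
      then show ?thesis using fy xy(6,7) comm \<open>x \<noteq> y\<close> \<open>x \<noteq> y'\<close> unfolding core_def by auto
    next
      case 2
      then show ?thesis using ex xy(6,7) comm \<open>x \<noteq> y\<close> \<open>x' \<noteq> y\<close> unfolding core_def by auto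
    next
      case 3
      have "y \<noteq> x'" "y' \<noteq> x" using \<open>x' \<noteq> y\<close> \<open>x \<noteq> y'\<close> by auto
      with 3 show ?thesis using ex fy xy(6,7) comm unfolding core_def
        by (intro conjI ballI) (auto intro: bexI[of _ x] bexI[of _ x'] bexI[of _ y] bexI[of _ y'])
    qed
  qed
  moreover have "{x, x', y, y'} \<subseteq> \<Union> M" using xy e by auto
  ultimately show False using MD(3) by blast
qed

text \<open>Contracting the edges of an acyclic matching yields a forest, in which N cannot have minimum
  degree two.\<close>

lemma acyclic_matching_contracted:
  assumes G: "simple_graph G" and M: "acyclic_matching G M" and N: "N \<subseteq> M" "N \<noteq> {}"
    and deg: "\<And>e. e \<in> N \<Longrightarrow> \<exists>f\<in>N. \<exists>g\<in>N. f \<noteq> g \<and> f \<noteq> e \<and> g \<noteq> e \<and> joined G e f \<and> joined G e g"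
  shows False
proof -
  note MD = acyclic_matchingD[OF G M]
  let ?nbr = "\<lambda>e v f u. f \<in> N \<and> f \<noteq> e \<and> u \<in> f \<and> {v, u} \<in> edges G"
  \<comment> \<open>The ends of all connecting edges. If both ends of an edge \<open>e\<close> of
    \<open>N\<close> lie in \<open>S\<close>, each has the other and a vertex outside
    \<open>e\<close> as neighbours. Otherwise all connections of \<open>e\<close> use one end, which
    then has neighbours in two different edges of \<open>N\<close>.\<close>
  define S where "S = {v. \<exists>e\<in>N. v \<in> e \<and> (\<exists>f u. ?nbr e v f u)}"
  have SI: "v \<in> S" if "e \<in> N" "v \<in> e" "?nbr e v f u" for e v f u
    using that unfolding S_def by blast
  have conn: "\<exists>x\<in>e. \<exists>u. ?nbr e x f u" if ef: "e \<in> N" "f \<in> N" "f \<noteq> e" "joined G e f" for e f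
  proof -
    obtain x u where "x \<in> e" "u \<in> f" "x = u \<or> {x, u} \<in> edges G"
      using ef(4) unfolding joined_def by blast
    moreover have "e \<inter> f = {}" using MD(2) N(1) ef by auto
    ultimately show ?thesis using ef by blast
  qed
  have "core G S"
    unfolding core_def
  proof (intro conjI ballI)
    obtain e where e: "e \<in> N" using N by blast
    then show "S \<noteq> {}" using deg[OF e] conn[OF e] SI[OF e] by blast
  next
    fix v assume "v \<in> S"
    then obtain e f u where v: "e \<in> N" "v \<in> e" "?nbr e v f u" unfolding S_def by blast
    have E: "e \<in> edges G" using v N MD(1) by auto
    obtain v' where v': "e = {v, v'}" "v \<noteq> v'" by (rule edge_partner[OF G E v(2)])
    have inS: "u \<in> S \<and> u \<notin> e" if "?nbr e x f u" "x \<in> e" for x f u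
    proof -
      have "?nbr f u e x" using that v(1) by (auto simp: insert_commute)
      moreover have "e \<inter> f = {}" using MD(2) N(1) v(1) that by auto
      ultimately show ?thesis using SI[of f u e x] that by blast
    qed
    show "\<exists>y\<in>S. \<exists>z\<in>S. y \<noteq> z \<and> {v, y} \<in> edges G \<and> {v, z} \<in> edges G"
    proof (cases "v' \<in> S")
      case True
      have "u \<in> S" "u \<notin> e" using inS[OF v(3,2)] by auto
      moreover have "u \<noteq> v'" using \<open>u \<notin> e\<close> v' by auto
      ultimately show ?thesis using True v(3) E v' by blast
    next
      case False
      have only: "\<exists>u. ?nbr e v g u" if gN: "g \<in> N" "g \<noteq> e" "joined G e g" for g
      proof -
        obtain x u where x: "x \<in> e" "?nbr e x g u" using conn[OF v(1) gN] by blast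
        then have "x \<in> S" using SI[OF v(1)] by blast
        then have "x = v" using False x(1) v' by auto
        then show ?thesis using x by blast
      qed
      obtain g h where gh: "g \<in> N" "h \<in> N" "g \<noteq> h" "g \<noteq> e" "h \<noteq> e" "joined G e g" "joined G e h"
        using deg[OF v(1)] by blast
      obtain a where a: "?nbr e v g a" using only gh by blast
      obtain b where b: "?nbr e v h b" using only gh by blast
      have "g \<inter> h = {}" using MD(2) N(1) gh by auto
      then have "a \<noteq> b" using a b by blast
      then show ?thesis using inS[OF a v(2)] inS[OF b v(2)] a b by blast
    qed
  qed
  moreover have "S \<subseteq> \<Union> M" using N(1) unfolding S_def by blast
  ultimately show False using MD(3) by blast
qed

text \<open>The edges of a forest without two separate edges are covered by two adjacent vertices: take
  the middle of a path on four vertices if there is one. It suffices to exclude cycles of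
  length at most five.\<close>

lemma edge_cover_by_pair:
  fixes J :: "'b \<Rightarrow> 'b \<Rightarrow> bool"
  assumes sym: "\<And>x y. J x y \<Longrightarrow> J y x"
    and K: "\<And>e f g h. {e, f, g, h} \<subseteq> M \<Longrightarrow> J e f \<Longrightarrow> J g h \<Longrightarrow> e \<noteq> f \<Longrightarrow> g \<noteq> h \<Longrightarrow>
      \<exists>x\<in>{e, f}. \<exists>y\<in>{g, h}. J x y"
    and C3: "\<And>x y z. {x, y, z} \<subseteq> M \<Longrightarrow> distinct [x, y, z] \<Longrightarrow> J x y \<Longrightarrow> J y z \<Longrightarrow> J z x \<Longrightarrow> False"
    and C4: "\<And>x y z u. {x, y, z, u} \<subseteq> M \<Longrightarrow> distinct [x, y, z, u] \<Longrightarrow> J x y \<Longrightarrow> J y z \<Longrightarrow> J z u \<Longrightarrow>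
      J u x \<Longrightarrow> False"
    and C5: "\<And>x y z u v. {x, y, z, u, v} \<subseteq> M \<Longrightarrow> distinct [x, y, z, u, v] \<Longrightarrow> J x y \<Longrightarrow> J y z \<Longrightarrow>
      J z u \<Longrightarrow> J u v \<Longrightarrow> J v x \<Longrightarrow> False"
  shows "indep J M \<or> (\<exists>e\<in>M. \<exists>f\<in>M. e \<noteq> f \<and> J e f \<and> indep J (M - {e, f}))"
proof (cases "\<exists>h g e f. {h, g, e, f} \<subseteq> M \<and> distinct [h, g, e, f] \<and> J h g \<and> J g e \<and> J e f")
  case True
  then obtain h g e f where M: "{h, g, e, f} \<subseteq> M" and d: "distinct [h, g, e, f]" and J: "J h g" "J g e" "J e f"
    by blast
  \<comment> \<open>An end \<open>h\<close> of the path has no neighbour besides \<open>g\<close>: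
    the edge to \<open>l\<close> would be in contact with the edge \<open>e\<close>,
    \<open>f\<close>, and the four possible contacts close cycles of lengths 3, 4, 4 and 5.\<close>
  have end_edge: False
    if M: "{h, g, e, f, l} \<subseteq> M" and d: "distinct [h, g, e, f]" and J: "J h g" "J g e" "J e f"
      and l: "l \<notin> {h, g, e}" "J h l" for h g e f l
  proof -
    have n1: "\<not> J h e" using C3[of h g e] M d J sym[of h e] by auto
    have n2: "\<not> J h f" using C4[of h g e f] M d J sym[of h f] by auto
    have n3: "\<not> J l e" using C4[of h l e g] M d J sym[of h l] sym[of g e] sym[of h g] l by auto
    have "l \<noteq> f" using n2 l by auto
    then have n4: "\<not> J l f" using C5[of h l f e g] M d J sym[of e f] sym[of g e] sym[of h g] l by auto
    have "\<exists>x\<in>{h, l}. \<exists>y\<in>{e, f}. J x y" by (rule K) (use M d J l in auto)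
    then show False using n1 n2 n3 n4 by blast
  qed
  have J': "J g h" "J e g" "J f e" using J sym by blast+
  have noh: "\<not> J h l \<and> \<not> J l h" if "l \<in> M" "l \<notin> {h, g, e}" for l
    using end_edge[of h g e f l] M d J that sym[of l h] by auto
  have nof: "\<not> J f l \<and> \<not> J l f" if "l \<in> M" "l \<notin> {f, e, g}" for l
    using end_edge[of f e g h l] M d J' that sym[of l f] by auto
  \<comment> \<open>For an edge \<open>k\<close>, \<open>l\<close> off the path with
    \<open>k\<close> adjacent to \<open>g\<close>, contact with the edge \<open>e\<close>,
    \<open>f\<close> would close a triangle or a four-cycle, or give \<open>f\<close> a further
    neighbour.\<close>
  have nog: "\<not> J k g"
    if kl: "k \<in> M" "l \<in> M" "k \<notin> {h, g, e, f}" "l \<notin> {h, g, e, f}" "k \<noteq> l" "J k l" for k l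
  proof
    assume kg: "J k g"
    have "\<exists>x\<in>{k, l}. \<exists>y\<in>{e, f}. J x y" by (rule K) (use M d J kl in auto)
    moreover have "\<not> J k f" "\<not> J l f" using nof[of k] nof[of l] kl by auto
    moreover have "\<not> J k e" using C3[of k g e] M d J(2) kg sym[of k e] kl by auto
    moreover have "\<not> J l e" using C4[of k g e l] M d J(2) kg sym[of k l] sym[of l e] kl by auto
    ultimately show False by blast
  qed
  \<comment> \<open>An edge missed by the middle pair \<open>g\<close>, \<open>e\<close> avoids
    \<open>h\<close> and \<open>f\<close>, yet needs contact with the edge \<open>h\<close>,
    \<open>g\<close>, which has just been excluded.\<close>
  have "k = l" if kl: "k \<in> M - {g, e}" "l \<in> M - {g, e}" "J k l" for k l
  proof (rule ccontr)
    assume ne: "k \<noteq> l"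
    have lk: "J l k" using sym kl(3) by blast
    have n: "k \<noteq> h" "l \<noteq> h" "k \<noteq> f" "l \<noteq> f"
      using noh[of l] noh[of k] nof[of l] nof[of k] kl ne by auto
    have "\<exists>x\<in>{k, l}. \<exists>y\<in>{h, g}. J x y" by (rule K) (use M d J(1) kl ne in auto)
    moreover have "\<not> J k h" "\<not> J l h" using noh[of k] noh[of l] kl n by auto
    moreover have "\<not> J k g" "\<not> J l g" using nog[of k l] nog[of l k] kl lk n ne by auto
    ultimately show False by blast
  qed
  then have "indep J (M - {g, e})" unfolding indep_def by blast
  moreover have "g \<in> M" "e \<in> M" "g \<noteq> e" using M d by auto
  ultimately show ?thesis using J(2) by blast
next
  case False
  then have no_path: "\<not> ({h, g, e, f} \<subseteq> M \<and> distinct [h, g, e, f] \<and> J h g \<and> J g e \<and> J e f)" for h g e f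
    by blast
  show ?thesis
  proof (rule disjCI)
    assume "\<not> (\<exists>e\<in>M. \<exists>f\<in>M. e \<noteq> f \<and> J e f \<and> indep J (M - {e, f}))"
    then have not_cover: "\<not> indep J (M - {e, f})" if "e \<in> M" "f \<in> M" "e \<noteq> f" "J e f" for e f
      using that by blast
    show "indep J M"
      unfolding indep_def
    proof (intro ballI impI, rule ccontr)
      fix e f assume e: "e \<in> M" "f \<in> M" "J e f" "e \<noteq> f"
      \<comment> \<open>The contact between \<open>e\<close>, \<open>f\<close> and an uncovered edge
        \<open>k\<close>, \<open>l\<close> would create a path on four vertices.\<close>
      then obtain k l where kl: "k \<in> M - {e, f}" "l \<in> M - {e, f}" "J k l" "k \<noteq> l"
        using not_cover[of e f] by (auto simp: indep_def)
      have "\<exists>x\<in>{e, f}. \<exists>y\<in>{k, l}. J x y" by (rule K) (use e kl in auto)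
      then show False
        using no_path[of f e k l] no_path[of f e l k] no_path[of e f k l] no_path[of e f l k]
          e kl sym[of e f] sym[of k l] by auto
    qed
  qed
qed

text \<open>\<open>P3_of_pair\<close> puts an induced path into each joined pair, so any two such
  pairs are in contact. Short cycles of joined edges contradict
  \<open>acyclic_matching_contracted\<close>.\<close>

lemma acyclic_matching_structure:
  assumes G: "simple_graph G" "free_of two_P3 G" and M: "acyclic_matching G M"
  shows "indep (joined G) M \<or>
    (\<exists>e\<in>M. \<exists>f\<in>M. e \<noteq> f \<and> joined G e f \<and> indep (joined G) (M - {e, f}))"
proof (rule edge_cover_by_pair)
  note MD = acyclic_matchingD[OF G(1) M]
  show sym: "joined G y x" if "joined G x y" for x y using that joined_sym by metis
  show "\<exists>x\<in>{e, f}. \<exists>y\<in>{g, h}. joined G x y"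
    if efgh: "{e, f, g, h} \<subseteq> M" "joined G e f" "joined G g h" "e \<noteq> f" "g \<noteq> h" for e f g h
  proof -
    have P3: "\<exists>a b c. {a, b, c} \<subseteq> e \<union> f \<and> induces_P3 G a b c"
      if ef: "e \<in> M" "f \<in> M" "joined G e f" "e \<noteq> f" for e f
      by (rule P3_of_pair[OF G(1) _ _ ef(3) acyclic_matching_not_crowded[OF G(1) M ef(1,2,4)]])
        (use ef(1,2) MD(1) in auto)
    obtain a b c where 1: "{a, b, c} \<subseteq> e \<union> f" "induces_P3 G a b c" using P3[of e f] efgh by auto
    obtain a' b' c' where 2: "{a', b', c'} \<subseteq> g \<union> h" "induces_P3 G a' b' c'" using P3[of g h] efgh by auto
    obtain x y where xy: "x \<in> {a, b, c}" "y \<in> {a', b', c'}" "x = y \<or> {x, y} \<in> edges G"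
      using two_P3_free_joined[OF G 1(2) 2(2)] by blast
    obtain p where "p \<in> {e, f}" "x \<in> p" using xy(1) 1(1) by blast
    moreover obtain q where "q \<in> {g, h}" "y \<in> q" using xy(2) 2(1) by blast
    ultimately show ?thesis using xy(3) unfolding joined_def by blast
  qed
  define deg2 where "deg2 N e \<longleftrightarrow>
    (\<exists>f\<in>N. \<exists>g\<in>N. f \<noteq> g \<and> f \<noteq> e \<and> g \<noteq> e \<and> joined G e f \<and> joined G e g)" for N e
  have deg2I: "deg2 N e" if "f \<in> N" "g \<in> N" "distinct [e, f, g]" "joined G e f" "joined G g e" for N e f g
    using that sym[of g e] unfolding deg2_def by auto
  have contr: False if "N \<subseteq> M" "N \<noteq> {}" "\<forall>e\<in>N. deg2 N e" for N
    using acyclic_matching_contracted[OF G(1) M that(1,2)] that(3) unfolding deg2_def by blast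
  show False if C: "{x, y, z} \<subseteq> M" "distinct [x, y, z]" "joined G x y" "joined G y z" "joined G z x" for x y z
  proof (rule contr[OF C(1)])
    have "deg2 {x, y, z} x" by (rule deg2I[of y _ z]) (use C in auto)
    moreover have "deg2 {x, y, z} y" by (rule deg2I[of z _ x]) (use C in auto)
    moreover have "deg2 {x, y, z} z" by (rule deg2I[of x _ y]) (use C in auto)
    ultimately show "\<forall>e\<in>{x, y, z}. deg2 {x, y, z} e" by simp
  qed simp
  show False if C: "{x, y, z, u} \<subseteq> M" "distinct [x, y, z, u]" "joined G x y" "joined G y z" "joined G z u"
    "joined G u x" for x y z u
  proof (rule contr[OF C(1)])
    have "deg2 {x, y, z, u} x" by (rule deg2I[of y _ u]) (use C in auto)
    moreover have "deg2 {x, y, z, u} y" by (rule deg2I[of z _ x]) (use C in auto)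
    moreover have "deg2 {x, y, z, u} z" by (rule deg2I[of u _ y]) (use C in auto)
    moreover have "deg2 {x, y, z, u} u" by (rule deg2I[of x _ z]) (use C in auto)
    ultimately show "\<forall>e\<in>{x, y, z, u}. deg2 {x, y, z, u} e" by simp
  qed simp
  show False if C: "{x, y, z, u, v} \<subseteq> M" "distinct [x, y, z, u, v]" "joined G x y" "joined G y z"
    "joined G z u" "joined G u v" "joined G v x" for x y z u v
  proof (rule contr[OF C(1)])
    let ?N = "{x, y, z, u, v}"
    have "deg2 ?N x" by (rule deg2I[of y _ v]) (use C in auto)
    moreover have "deg2 ?N y" by (rule deg2I[of z _ x]) (use C in auto)
    moreover have "deg2 ?N z" by (rule deg2I[of u _ y]) (use C in auto)
    moreover have "deg2 ?N u" by (rule deg2I[of v _ z]) (use C in auto)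
    moreover have "deg2 ?N v" by (rule deg2I[of x _ u]) (use C in auto)
    ultimately show "\<forall>e\<in>?N. deg2 ?N e" by simp
  qed simp
qed

text \<open>An edge joined to both \<open>e\<close> and \<open>f\<close> would form a triangle with
  them after contraction. This shows that the filter \<open>allowed\<close> discards nothing
  relevant.\<close>

lemma acyclic_matching_pair_far:
  assumes G: "simple_graph G" and M: "acyclic_matching G M"
    and e: "e \<in> M" "f \<in> M" "e \<noteq> f" "joined G e f" and g: "g \<in> M - {e, f}"
  shows "\<not> crowded G g e \<and> \<not> crowded G g f \<and> \<not> (joined G g e \<and> joined G g f)"
proof -
  have "\<not> (joined G g e \<and> joined G g f)"
  proof
    assume J: "joined G g e \<and> joined G g f"
    then have J': "joined G e g" "joined G f g" "joined G f e" using e(4) joined_sym[of G] by auto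
    show False
      by (rule acyclic_matching_contracted[OF G M, of "{e, f, g}"]) (use J J' e g in auto)
  qed
  then show ?thesis using acyclic_matching_not_crowded[OF G M] e g by blast
qed

section \<open>The algorithm\<close>

definition eu :: "tree \<Rightarrow> nat" where
  "eu i = val (left (left i))"

definition ev :: "tree \<Rightarrow> nat" where
  "ev i = val (right (left i))"

definition ends :: "tree \<Rightarrow> nat set" where
  "ends i = {eu i, ev i}"

definition adj :: "tree list \<Rightarrow> nat \<Rightarrow> nat \<Rightarrow> bool" where
  "adj g a b \<longleftrightarrow> (\<exists>i\<in>set g. eu i = a \<and> ev i = b \<or> eu i = b \<and> ev i = a)"

definition touch :: "tree list \<Rightarrow> tree \<Rightarrow> tree \<Rightarrow> bool" where
  "touch g i j \<longleftrightarrow> eu i = eu j \<or> eu i = ev j \<or> ev i = eu j \<or> ev i = ev j \<or>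
     adj g (eu i) (eu j) \<or> adj g (eu i) (ev j) \<or> adj g (ev i) (eu j) \<or> adj g (ev i) (ev j)"

text \<open>The disjunction lists all six pairs out of the four possible connecting edges.\<close>

definition crowd :: "tree list \<Rightarrow> tree \<Rightarrow> tree \<Rightarrow> bool" where
  "crowd g i j \<longleftrightarrow> eu i = eu j \<or> eu i = ev j \<or> ev i = eu j \<or> ev i = ev j \<or>
     adj g (eu i) (eu j) \<and> (adj g (eu i) (ev j) \<or> adj g (ev i) (eu j) \<or> adj g (ev i) (ev j)) \<or>
     adj g (eu i) (ev j) \<and> (adj g (ev i) (eu j) \<or> adj g (ev i) (ev j)) \<or>
     adj g (ev i) (eu j) \<and> adj g (ev i) (ev j)"

definition allowed :: "tree list \<Rightarrow> tree \<Rightarrow> tree \<Rightarrow> tree list" where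
  "allowed g e f = filter (\<lambda>i. \<not> crowd g i e \<and> \<not> crowd g i f \<and> \<not> (touch g i e \<and> touch g i f)) g"

text \<open>\<open>e\<close> and \<open>f\<close> are taken even if their weights are negative,
  since they may make room for heavier sets. A guess that fails the test falls back to the empty
  matching.\<close>

definition pair_solution :: "tree list \<Rightarrow> tree \<Rightarrow> tree \<Rightarrow> tree list" where
  "pair_solution g e f =
     (if touch g e f \<and> \<not> crowd g e f then e # f # mwis (touch g) (allowed g e f) else [])"

definition best_pair_solution :: "tree list \<Rightarrow> tree list" where
  "best_pair_solution g = best_of (\<lambda>e. best_of (\<lambda>f. pair_solution g e f) g) g"

definition opt :: "tree list \<Rightarrow> tree list" where
  "opt g = (if wsum (best_pair_solution g) < wsum (mwis (touch g) g)
     then mwis (touch g) g else best_pair_solution g)"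

section \<open>Polynomial running time of the algorithm\<close>

lemma PFB_adj:
  assumes "PFL k g" "PF k A" "PF k B"
  shows "PFB k (\<lambda>e. adj (g e) (val (A e)) (val (B e)))"
  unfolding adj_def eu_def ev_def
  by (intro PFB_ex[OF assms(1)] PFB_disj PFB_conj PFB_val_eq PF_left PF_right PF_vars
      PF_weaken[OF assms(2)] PF_weaken[OF assms(3)]) simp_all

lemma PFB_touch:
  assumes "PFL k g" "PF k i" "PF k j"
  shows "PFB k (\<lambda>e. touch (g e) (i e) (j e))"
  unfolding touch_def eu_def ev_def
  by (intro PFB_disj PFB_val_eq PFB_adj PF_left PF_right assms)

lemma PFB_crowd:
  assumes "PFL k g" "PF k i" "PF k j"
  shows "PFB k (\<lambda>e. crowd (g e) (i e) (j e))"
  unfolding crowd_def eu_def ev_def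
  by (intro PFB_disj PFB_conj PFB_val_eq PFB_adj PF_left PF_right assms)

lemma PFL_extend:
  assumes "PFL k g" "PF k x" "PFL k A"
  shows "PFL k (\<lambda>e. extend (touch (g e)) (x e) (A e))"
  unfolding extend_def bent_def
  by (intro PFL_If PFL_Cons PFB_ex PFB_conj PFB_not PFB_iff PFB_touch assms
      PF_weaken[OF assms(3)] PF_weaken[OF PF_weaken[OF assms(1)]] PF_weaken[OF PF_weaken[OF assms(2)]]
      PF_vars) simp_all

lemma PFL_improve:
  assumes "PFL k g" "PF k v" "PFL k I"
  shows "PFL k (\<lambda>e. improve (touch (g e)) (v e) (I e))"
  unfolding improve_def
  by (intro PFL_If PFL_Cons PFB_wsum_less PFL_filter PFB_not PFB_touch assms
      PF_weaken[OF assms(1)] PF_weaken[OF assms(2)] PF_vars) simp_all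

lemma nodes_filter_le: "nodes (lst (filter P xs)) \<le> nodes (lst xs)"
  by (induction xs) auto

lemma PFL_heaviest:
  assumes "PFL k g" "PFL k A"
  shows "PFL k (\<lambda>e. heaviest (touch (g e)) (A e))"
  unfolding heaviest_def
proof (intro PFL_foldr_grow assms PFL_Nil PFL_improve PF_elems PF_vars PF_weaken[OF PF_weaken[OF assms(1)]])
  show "nodes (lst (improve (touch (g e)) x acc)) \<le> Suc (nodes x + nodes (lst acc))" for x acc e
    using nodes_filter_le[of _ acc] by (auto simp: improve_def intro: le_SucI trans_le_add2)
qed simp_all

lemma PFL_base:
  assumes "PFL k g" "PFL k L" "PF k v" "PF k a" "PF k b" "PF k d" "PF k d'"
  shows "PFL k (\<lambda>e. base (touch (g e)) (L e) (v e) (a e) (b e) (d e) (d' e))"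
  unfolding base_def
  by (intro PFL_Cons PFL_filter PFB_conj PFB_not PFB_touch assms assms[THEN PF_weaken] PF_vars) simp_all

lemma PFL_solve:
  assumes "PFL k g" "PFL k L" "PFL k B"
  shows "PFL k (\<lambda>e. solve (touch (g e)) (L e) (B e))"
  unfolding solve_def
proof (intro PFL_heaviest PFL_foldr_grow assms PFL_extend PF_elems PF_vars PF_weaken[OF PF_weaken[OF assms(1)]])
  show "nodes (lst (extend (touch (g e)) x acc)) \<le> Suc (nodes x + nodes (lst acc))" for x acc e
    by (simp add: extend_def)
qed simp_all

lemma PFL_solve_bases:
  assumes g: "PFL k g" and L: "PFL k L"
  shows "PFL k (\<lambda>e. solve_bases (touch (g e)) (L e))"
proof -
  \<comment> \<open>One shift of the environment for each of the five nested loops.\<close>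
  note w1 = g[THEN PF_weaken] L[THEN PF_weaken]
  note w2 = w1[THEN PF_weaken]
  note w3 = w2[THEN PF_weaken]
  note w4 = w3[THEN PF_weaken]
  note w5 = w4[THEN PF_weaken]
  show ?thesis
    unfolding solve_bases_def
    by (intro PFL_best_of L w1 w2 w3 w4 w5 PFL_solve PFL_base PF_vars) simp_all
qed

lemma PFL_mwis:
  assumes "PFL k g" "PFL k L"
  shows "PFL k (\<lambda>e. mwis (touch (g e)) (L e))"
  unfolding mwis_def
  by (intro PFL_If PFB_wsum_less PFL_solve PFL_solve_bases PFL_Nil assms)

lemma PFL_pair_solution:
  assumes "PFL k g" "PF k e'" "PF k f"
  shows "PFL k (\<lambda>e. pair_solution (g e) (e' e) (f e))"
  unfolding pair_solution_def allowed_def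
  by (intro PFL_If PFB_conj PFB_not PFB_touch PFB_crowd PFL_Cons PFL_Nil PFL_mwis PFL_filter assms
      assms[THEN PF_weaken] PF_vars) simp_all

lemma PFL_opt:
  assumes "PFL k g"
  shows "PFL k (\<lambda>e. opt (g e))"
  unfolding opt_def best_pair_solution_def
  by (intro PFL_If PFB_wsum_less PFL_best_of PFL_pair_solution PFL_mwis assms PF_weaken[OF assms]
      PF_weaken[OF PF_weaken[OF assms]] PF_vars) simp_all

section \<open>Correctness for a list of items that represents each edge once\<close>

lemma reflp_touch: "reflp (touch g)"
  by (auto simp: reflp_def touch_def)

lemma adj_sym: "adj g a b \<longleftrightarrow> adj g b a"
  by (auto simp: adj_def)

lemma symp_touch: "symp (touch g)"
  by (rule sympI) (unfold touch_def, use adj_sym in metis)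

context
  fixes G :: "nat graph" and g :: "tree list"
  assumes G: "simple_graph G" "free_of two_P3 G"
    and inj: "inj_on ends (set g)" and ends: "ends ` set g = edges G"
begin

lemma adj_iff: "adj g a b \<longleftrightarrow> {a, b} \<in> edges G"
  unfolding adj_def ends[symmetric] by (auto simp: ends_def doubleton_eq_iff image_iff)

lemma touch_iff: "touch g i j \<longleftrightarrow> joined G (ends i) (ends j)"
  unfolding touch_def joined_def ends_def adj_iff by auto

lemma two_pairs:
  assumes "p \<noteq> q" "r \<noteq> s"
  shows "(\<exists>x\<in>{p, q}. \<exists>y\<in>{r, s}. \<exists>x'\<in>{p, q}. \<exists>y'\<in>{r, s}. (x, y) \<noteq> (x', y') \<and> {x, y} \<in> E \<and> {x', y'} \<in> E) \<longleftrightarrow>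
    {p, r} \<in> E \<and> ({p, s} \<in> E \<or> {q, r} \<in> E \<or> {q, s} \<in> E) \<or>
    {p, s} \<in> E \<and> ({q, r} \<in> E \<or> {q, s} \<in> E) \<or> {q, r} \<in> E \<and> {q, s} \<in> E"
  using assms
  by (cases "{p, r} \<in> E"; cases "{p, s} \<in> E"; cases "{q, r} \<in> E"; cases "{q, s} \<in> E") simp_all

lemma crowd_iff:
  assumes "i \<in> set g" "j \<in> set g"
  shows "crowd g i j \<longleftrightarrow> crowded G (ends i) (ends j)"
proof -
  have "ends i \<in> edges G" "ends j \<in> edges G" using assms ends by auto
  then have ne: "eu i \<noteq> ev i" "eu j \<noteq> ev j"
    using simple_graphD(1)[OF G(1)] unfolding ends_def by blast+
  have "{eu i, ev i} \<inter> {eu j, ev j} \<noteq> {} \<longleftrightarrow>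
      eu i = eu j \<or> eu i = ev j \<or> ev i = eu j \<or> ev i = ev j" by blast
  then show ?thesis
    unfolding crowd_def crowded_def ends_def adj_iff two_pairs[OF ne] by (simp only: disj_assoc)
qed

lemma indep_touch_iff:
  assumes "D \<subseteq> set g"
  shows "indep (touch g) D \<longleftrightarrow> indep (joined G) (ends ` D)"
  using assms inj unfolding indep_def touch_iff by (auto simp: inj_on_def subset_iff)

lemma unseparated_touch:
  assumes "set L \<subseteq> set g"
  shows "unseparated (touch g) (set L)"
proof -
  have bent: "bent (touch g) v a b \<longleftrightarrow> bent (joined G) (ends v) (ends a) (ends b)" for v a b
    by (simp add: bent_def touch_iff)
  have E: "ends i \<in> edges G" if "i \<in> set L" for i using that assms ends by auto
  show ?thesis
    unfolding unseparated_def bent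
  proof (intro ballI impI, elim conjE)
    fix v a b x y z
    assume L: "v \<in> set L" "a \<in> set L" "b \<in> set L" "x \<in> set L" "y \<in> set L" "z \<in> set L"
      and "bent (joined G) (ends v) (ends a) (ends b)" "bent (joined G) (ends x) (ends y) (ends z)"
    then have "\<exists>p\<in>{ends v, ends a, ends b}. \<exists>q\<in>{ends x, ends y, ends z}. joined G p q"
      using unseparated_joined[OF G] L[THEN E] unfolding unseparated_def by blast
    then show "\<exists>p\<in>{v, a, b}. \<exists>q\<in>{x, y, z}. touch g p q" unfolding touch_iff by simp
  qed
qed

lemma mwis_touch:
  assumes L: "set L \<subseteq> set g"
  defines "I \<equiv> mwis (touch g) L"
  shows "distinct I" "set I \<subseteq> set L" "indep (joined G) (ends ` set I)"
    "\<And>D. D \<subseteq> set L \<Longrightarrow> indep (joined G) (ends ` D) \<Longrightarrow> sum weight D \<le> wsum I"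
proof -
  have I: "indep_list (touch g) I" "set I \<subseteq> set L"
    using mwis_sound[OF symp_touch] by (auto simp: I_def)
  show "distinct I" by (rule distinct_indep_list[OF reflp_touch I(1)])
  show "set I \<subseteq> set L" by (rule I(2))
  have "indep (touch g) (set I)"
    using I(1)
  proof (induction I)
    case (Cons i I)
    then show ?case using symp_touch[of g] by (auto simp: indep_def dest: sympD)
  qed (simp add: indep_def)
  then show "indep (joined G) (ends ` set I)"
    using indep_touch_iff[of "set I"] I(2) L by auto
  show "sum weight D \<le> wsum I" if "D \<subseteq> set L" "indep (joined G) (ends ` D)" for D
    unfolding I_def
    using that L indep_touch_iff[of D]
    by (intro mwis_optimal[OF reflp_touch symp_touch unseparated_touch[OF L]]) auto
qed

lemma set_allowed: "set (allowed g e f) \<subseteq> set g"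
  by (auto simp: allowed_def)

definition solution :: "tree list \<Rightarrow> bool" where
  "solution I \<longleftrightarrow> distinct I \<and> set I \<subseteq> set g \<and> acyclic_matching G (ends ` set I)"

lemma solution_mwis: "solution (mwis (touch g) g)"
  using mwis_touch(1-3)[OF order_refl] image_mono[OF mwis_touch(2)[OF order_refl], of ends] ends
  by (simp add: solution_def acyclic_matching_of_indep[OF G(1)])

lemma solution_Nil: "solution []"
  by (auto simp: solution_def indep_def intro!: acyclic_matching_of_indep[OF G(1)])

lemma solution_pair:
  assumes e: "e \<in> set g" "f \<in> set g"
  shows "solution (pair_solution g e f)"
proof (cases "touch g e f \<and> \<not> crowd g e f")
  case True
  define I where "I = mwis (touch g) (allowed g e f)"
  note I = mwis_touch[OF set_allowed[of e f], folded I_def]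
  have Ig: "set I \<subseteq> set g" using I(2) set_allowed by blast
  have far: "\<not> crowded G (ends i) (ends e) \<and> \<not> crowded G (ends i) (ends f) \<and>
      \<not> (joined G (ends i) (ends e) \<and> joined G (ends i) (ends f))" if "i \<in> set I" for i
  proof -
    have "i \<in> set (allowed g e f)" "i \<in> set g" using that I(2) Ig by auto
    then show ?thesis using crowd_iff e by (simp add: allowed_def touch_iff)
  qed
  have ef: "\<not> crowded G (ends e) (ends f)" using True crowd_iff e by simp
  have "acyclic_matching G (insert (ends e) (insert (ends f) (ends ` set I)))"
  proof (rule acyclic_matching_of_pair[OF G(1) _ I(3) _ _ ef])
    show "ends ` set I \<subseteq> edges G" "ends e \<in> edges G" "ends f \<in> edges G" using Ig e ends by auto
  qed (use far in auto)
  \<comment> \<open>Every edge meets itself, so \<open>far\<close> keeps \<open>e\<close> and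
    \<open>f\<close> out of \<open>I\<close>, and \<open>ef\<close> makes them different.\<close>
  moreover have "crowded G (ends i) (ends i)" for i by (simp add: crowded_def ends_def)
  then have "e \<notin> set I" "f \<notin> set I" "e \<noteq> f" using far ef by blast+
  ultimately show ?thesis
    using True I(1) Ig e by (simp add: pair_solution_def solution_def I_def)
next
  case False
  then show ?thesis using solution_Nil by (simp only: pair_solution_def if_False)
qed

lemma solution_opt: "solution (opt g)"
proof -
  have "solution (best_pair_solution g)"
    unfolding best_pair_solution_def
    by (intro best_of_induct[where P = solution] solution_Nil solution_pair)
  then show ?thesis using solution_mwis by (simp add: opt_def)
qed

text \<open>Either all of \<open>D\<close> is independent in the conflict graph, or the correct
  guess of \<open>e\<close> and \<open>f\<close> leaves an independent set of allowed items; the two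
  alternatives match the two candidates of \<open>opt\<close>.\<close>

lemma opt_optimal:
  assumes D: "D \<subseteq> set g" "acyclic_matching G (ends ` D)"
  shows "sum weight D \<le> wsum (opt g)"
  using acyclic_matching_structure[OF G D(2)]
proof
  assume "indep (joined G) (ends ` D)"
  then have "sum weight D \<le> wsum (mwis (touch g) g)" by (rule mwis_touch(4)[OF order_refl D(1)])
  then show ?thesis by (auto simp: opt_def)
next
  assume "\<exists>e\<in>ends ` D. \<exists>f\<in>ends ` D. e \<noteq> f \<and> joined G e f \<and> indep (joined G) (ends ` D - {e, f})"
  then obtain e f where e: "e \<in> D" "f \<in> D" "ends e \<noteq> ends f" "joined G (ends e) (ends f)"
    "indep (joined G) (ends ` D - {ends e, ends f})" by blast
  let ?D = "D - {e, f}"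
  have fin: "finite D" using D(1) finite_subset by auto
  have eg: "e \<in> set g" "f \<in> set g" using e D by auto
  have img: "ends ` ?D = ends ` D - {ends e, ends f}"
    using inj_on_image_set_diff[OF inj, of D "{e, f}"] D(1) eg by (simp add: Diff_subset[THEN order_trans])
  have "?D \<subseteq> set (allowed g e f)"
  proof
    fix i assume i: "i \<in> ?D"
    then have "ends i \<in> ends ` D - {ends e, ends f}" using img by blast
    from acyclic_matching_pair_far[OF G(1) D(2) imageI[OF e(1)] imageI[OF e(2)] e(3,4) this]
    show "i \<in> set (allowed g e f)"
      using i D(1) eg crowd_iff by (auto simp: allowed_def touch_iff)
  qed
  then have "sum weight ?D \<le> wsum (mwis (touch g) (allowed g e f))"
    by (rule mwis_touch(4)[OF set_allowed]) (simp add: img e(5))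
  moreover have "sum weight D = weight e + weight f + sum weight ?D"
  proof -
    have "e \<noteq> f" using e(3) by auto
    have "sum weight D = sum weight ?D + sum weight {e, f}"
      using e fin by (intro sum.subset_diff) auto
    then show ?thesis using \<open>e \<noteq> f\<close> by simp
  qed
  moreover have "touch g e f \<and> \<not> crowd g e f"
    using acyclic_matching_not_crowded[OF G(1) D(2) imageI[OF e(1)] imageI[OF e(2)] e(3)] e(4) eg
    by (simp add: touch_iff crowd_iff)
  ultimately have "sum weight D \<le> wsum (pair_solution g e f)"
    by (simp add: pair_solution_def)
  also have "\<dots> \<le> wsum (best_of (pair_solution g e) g)" by (rule best_of_ge[OF eg(2)])
  also have "\<dots> \<le> wsum (best_pair_solution g)"
    unfolding best_pair_solution_def using best_of_ge[OF eg(1), of "\<lambda>e. best_of (pair_solution g e) g"] .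
  also have "\<dots> \<le> wsum (opt g)" by (auto simp: opt_def)
  finally show ?thesis .
qed

end

section \<open>Encoded inputs and the complete program\<close>

lemma enc_list_map: "enc_list enc xs = lst (map enc xs)"
  by (induction xs) (auto simp: enc_list_def)

abbreviation enc_item :: "(nat set \<Rightarrow> rat) \<Rightarrow> nat \<times> nat \<Rightarrow> tree" where
  "enc_item w e \<equiv> Node (enc_edge e) (enc_rat (w (edge_of e)))"

lemma ends_enc_item: "ends (enc_item w e) = edge_of e"
  by (cases e) (simp add: ends_def eu_def ev_def enc_edge_def edge_of_def)

lemma weight_enc_item: "weight (enc_item w e) = w (edge_of e)"
proof -
  obtain p q where pq: "quotient_of (w (edge_of e)) = (p, q)" by force
  have "q > 0" using quotient_of_denom_pos[OF pq] .
  have r: "right (enc_item w e) = Node (Node (enc_bool (p < 0)) (enc_nat (nat \<bar>p\<bar>))) (enc_nat (nat q))"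
    by (simp add: enc_rat_def enc_int_def pq)
  have "weight (enc_item w e) = of_int p / of_int q"
    using \<open>q > 0\<close> unfolding weight_def wneg_def wnum_def wden_def r by (simp add: of_nat_nat)
  then show ?thesis using quotient_of_div[OF pq] by simp
qed

lemma opt_correct:
  assumes G: "simple_graph G" "free_of two_P3 G" and x: "encodes_weighted_graph G w x"
  shows "\<exists>M. encodes_edge_set M (lst (map left (opt (elems (right x))))) \<and>
    max_weight_acyclic_matching G w M"
proof -
  obtain es where es: "lists_edges es (edges G)" "elems (right x) = map (enc_item w) es"
    using x enc_list_map[of "enc_item w"] unfolding encodes_weighted_graph_def by auto
  define g where "g = map (enc_item w) es"
  have ends: "map ends g = map edge_of es" by (simp add: g_def ends_enc_item)
  then have "distinct (map ends g)" using es(1) by (simp add: lists_edges_def)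
  then have inj: "inj_on ends (set g)" by (simp add: distinct_map)
  have img: "ends ` set g = edges G"
  proof -
    have "ends ` set g = set (map ends g)" by simp
    also have "\<dots> = edges G" unfolding ends using es(1) by (simp add: lists_edges_def)
    finally show ?thesis .
  qed
  have w: "weight i = w (ends i)" if i: "i \<in> set g" for i
  proof -
    obtain e where "i = enc_item w e" using i by (auto simp: g_def)
    then show ?thesis by (simp only: weight_enc_item ends_enc_item)
  qed
  define I where "I = opt g"
  let ?M = "ends ` set I"
  have I: "distinct I" "set I \<subseteq> set g" "acyclic_matching G ?M"
    using solution_opt[OF G inj img] by (auto simp: I_def solution_def[OF G inj img])
  have sum: "(\<Sum>e\<in>ends ` D. w e) = sum weight D" if "D \<subseteq> set g" for D
  proof -
    have "(\<Sum>e\<in>ends ` D. w e) = (\<Sum>i\<in>D. w (ends i))"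
      using sum.reindex[OF inj_on_subset[OF inj that]] by (simp add: comp_def)
    also have "\<dots> = sum weight D" using w that by (intro sum.cong) auto
    finally show ?thesis .
  qed
  have "max_weight_acyclic_matching G w ?M"
    unfolding max_weight_acyclic_matching_def
  proof (intro conjI allI impI I(3))
    fix M' assume M': "acyclic_matching G M'"
    define D where "D = {i \<in> set g. ends i \<in> M'}"
    have "M' \<subseteq> edges G" by (rule acyclic_matchingD(1)[OF G(1) M'])
    then have D: "ends ` D = M'" "D \<subseteq> set g" unfolding img[symmetric] D_def by blast+
    have "sum weight D \<le> wsum I"
      unfolding I_def using D M' by (intro opt_optimal[OF G inj img]) auto
    also have "wsum I = sum weight (set I)" using I(1) by (simp add: sum_list_distinct_conv_sum_set)
    finally show "sum w M' \<le> sum w ?M" using sum[OF D(2)] sum[OF I(2)] D(1) by simp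
  qed
  moreover have "encodes_edge_set ?M (lst (map left I))"
  proof -
    \<comment> \<open>The chosen items are entries of the input, so stripping the weights with
      \<open>left\<close> leaves properly encoded edges.\<close>
    have "\<exists>es'. I = map (enc_item w) es' \<and> set es' \<subseteq> set es"
      using I(2)
    proof (induction I)
      case (Cons i I)
      then obtain es' where "I = map (enc_item w) es'" "set es' \<subseteq> set es" by auto
      moreover obtain e where "i = enc_item w e" "e \<in> set es" using Cons.prems by (auto simp: g_def)
      ultimately show ?case by (intro exI[of _ "e # es'"]) simp
    qed simp
    then obtain es' where es': "I = map (enc_item w) es'" by blast
    have map: "map ends I = map edge_of es'" by (simp add: es' ends_enc_item)
    have "distinct (map ends I)" using I(1) inj_on_subset[OF inj I(2)] by (simp add: distinct_map)
    then have "lists_edges es' ?M"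
      using map list.set_map[of ends I] by (simp add: lists_edges_def)
    moreover have "lst (map left I) = enc_list enc_edge es'"
      by (simp add: es' enc_list_map[of enc_edge] comp_def)
    ultimately show ?thesis unfolding encodes_edge_set_def by blast
  qed
  ultimately show ?thesis using es(2) by (auto simp: I_def g_def)
qed

theorem theorem4:
  "\<exists>(P :: program) (p :: nat poly). \<forall>(G :: nat graph) (w :: nat set \<Rightarrow> rat) (x :: tree).
     simple_graph G \<and> free_of two_P3 G \<and> encodes_weighted_graph G w x \<longrightarrow>
       (\<exists>y t M. runs P x y t \<and> t \<le> poly p (nodes x) \<and>
          encodes_edge_set M y \<and> max_weight_acyclic_matching G w M)"
proof -
  \<comment> \<open>Only the edge list of the input is read, as isolated vertices do not affect
    matchings.\<close>
  let ?F = "\<lambda>e. lst (map left (opt (elems (right (hd e)))))"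
  have "PF 1 ?F"
    by (intro PFL_map_left PFL_opt PF_elems PF_right PF_vars) simp
  \<comment> \<open>Address 0 is reserved for \<open>b\<close>, which \<open>runs\<close> calls.
    Since the code works behind any prefix of length 1, the prefix can be \<open>b\<close>
    itself.\<close>
  then obtain R b p where R: "\<And>Q S. length Q = 1 \<Longrightarrow> impl (Q @ R @ S) p (1, ?F) b"
    unfolding PF_def by blast
  let ?P = "b # R"
  \<comment> \<open>The additional \<open>1 + nodes x\<close> pays for the outer call and for
    reading the input.\<close>
  have run: "\<exists>t. runs ?P x (?F [x]) t \<and> t \<le> poly (p + [:1, 1:]) (nodes x)" for x
  proof -
    have "impl ?P p (1, ?F) b" using R[of "[b]" "[]"] by simp
    then obtain t where t: "eval ?P [x] b (?F [x]) t" "t \<le> poly p (sz [x])"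
      by (rule implE[where env = "[x]"]) auto
    have "evals ?P [x] [Var 0] [x] (nodes x + 0)"
      using eval_Var[of 0 "[x]" ?P] by (intro evals_Cons evals_Nil) auto
    then have "eval ?P [x] (Call 0 [Var 0]) (?F [x]) (Suc (nodes x + 0 + t))"
      using t by (intro eval_Call) auto
    then show ?thesis using t(2) by (intro exI[of _ "Suc (nodes x + 0 + t)"]) (auto simp: runs_def)
  qed
  show ?thesis
  proof (intro exI[of _ ?P] exI[of _ "p + [:1, 1:]"] allI impI, elim conjE)
    fix G :: "nat graph" and w x
    assume "simple_graph G" "free_of two_P3 G" "encodes_weighted_graph G w x"
    from opt_correct[OF this] run[of x]
    show "\<exists>y t M. runs ?P x y t \<and> t \<le> poly (p + [:1, 1:]) (nodes x) \<and>
        encodes_edge_set M y \<and> max_weight_acyclic_matching G w M"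
      by (metis list.sel(1))
  qed
qed

end
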